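(* Let $(X_i)_{i\ge 1}$ be i.i.d. standard normal random variables and $X_{(n)}=\max_{1\le i\le n}X_i$. For $n\ge 2$ let $$a_n=\sqrt{2\log n},\qquad b_n=\sqrt{2\log n}-\frac{\log(\sqrt{4\pi\log n})}{\sqrt{2\log n}},\qquad Y_n=a_n(X_{(n)}-b_n).$$ Let $\Lambda$ be the standard Gumbel distribution, with distribution function $\Lambda(x)=e^{-e^{-x}}$, and let $\mathcal{L}(Y_n)$ be the distribution of $Y_n$. Then, as $n\to\infty$, $$\sup_{x\in\mathbb{R}}|\mathbb{P}(Y_n\le x)-\Lambda(x)|=\frac{(\log\log n)^2}{16e\log n}(1+o(1)),$$ $$W_1(\mathcal{L}(Y_n),\Lambda)=\frac{(\log\log n)^2}{16\log n}(1+o(1)),$$ $$\|\mathcal{L}(Y_n)-\Lambda\|_{\rm TV}=\frac{(\log\log n)^2}{8e\log n}(1+o(1)),$$ $$D_{\rm KL}(\mathcal{L}(Y_n)|\Lambda)=\frac{(\log\log n)^4}{512(\log n)^2}(1+o(1)),$$ $$I(\mathcal{L}(Y_n)|\Lambda)=\frac{(\log\log n)^4}{512(\log n)^2}(1+o(1)).$$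
   Context: For probability distributions $\mu,\nu$ on $\mathbb{R}$ with densities $f,g$ and distribution functions $F_\mu,F_\nu$, the following conventions are used. - $W_1(\mu,\nu)=\int_{\mathbb{R}}|F_\mu(x)-F_\nu(x)|\,dx$. - $\|\mu-\nu\|_{\rm TV}=\int_{\mathbb{R}}|f(x)-g(x)|\,dx$ (no factor $1/2$). - $D_{\rm KL}(\mu|\nu)=\int_{\mathbb{R}}f(x)\log\frac{f(x)}{g(x)}\,dx$. - $I(\mu|\nu)=\int_{\mathbb{R}}|(\sqrt{f/g})'(x)|^2g(x)\,dx=\frac14\int_{\mathbb{R}}[(\log\frac fg)'(x)]^2f(x)\,dx$. The density of $\Lambda$ is $e^{-x-e^{-x}}$. All logarithms are natural. *)

theory Defs
  imports "HOL-Probability.Probability"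
begin

(* The real-valued integrals below are Bochner integrals, which are 0 when the integrand is not
   integrable. A quantity asymptotic to a positive sequence is eventually non-zero, so an
   asymptotic statement of that kind entails integrability for all large indices. *)

definition W1_dist :: "real measure \<Rightarrow> real measure \<Rightarrow> real" where
  "W1_dist \<mu> \<nu> = (\<integral>x. \<bar>cdf \<mu> x - cdf \<nu> x\<bar> \<partial>lborel)"

(* Without the factor 1/2. *)
definition TV_dist :: "real measure \<Rightarrow> real measure \<Rightarrow> real" where
  "TV_dist \<mu> \<nu> =
     (\<integral>x. \<bar>enn2real (RN_deriv lborel \<mu> x) - enn2real (RN_deriv lborel \<nu> x)\<bar> \<partial>lborel)"

(* KL_divergence takes the base of the logarithm first and the reference measure second. *)
definition KL_div :: "real measure \<Rightarrow> real measure \<Rightarrow> real" where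
  "KL_div \<mu> \<nu> = KL_divergence (exp 1) \<nu> \<mu>"

(* The relative Fisher information differentiates the densities pointwise, so it needs a specific
   version of them. A measure has at most one continuous density: see continuous_density_eq. *)
definition continuous_density :: "real measure \<Rightarrow> real \<Rightarrow> real" where
  "continuous_density \<mu> =
     (THE f. continuous_on UNIV f \<and> (\<forall>x. 0 \<le> f x) \<and> \<mu> = density lborel (\<lambda>x. ennreal (f x)))"

definition relative_Fisher_information :: "real measure \<Rightarrow> real measure \<Rightarrow> real" where
  "relative_Fisher_information \<mu> \<nu> =
     (\<integral>x. (deriv (\<lambda>y. sqrt (continuous_density \<mu> y / continuous_density \<nu> y)) x)\<^sup>2
        * continuous_density \<nu> x \<partial>lborel)"

definition gumbel :: "real measure" where
  "gumbel = density lborel (\<lambda>x. ennreal (exp (- x - exp (- x))))"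

definition norm_a :: "nat \<Rightarrow> real" where
  "norm_a n = sqrt (2 * ln (real n))"

definition norm_b :: "nat \<Rightarrow> real" where
  "norm_b n = sqrt (2 * ln (real n)) - ln (sqrt (4 * pi * ln (real n))) / sqrt (2 * ln (real n))"

definition normalized_max :: "(nat \<Rightarrow> 'a \<Rightarrow> real) \<Rightarrow> nat \<Rightarrow> 'a \<Rightarrow> real" where
  "normalized_max X n \<omega> = norm_a n * ((MAX i\<in>{1..n}. X i \<omega>) - norm_b n)"

lemma continuous_AE_lborel_eq:
  fixes f g :: "real \<Rightarrow> real"
  assumes f: "continuous_on UNIV f" and g: "continuous_on UNIV g"
    and eq: "AE x in lborel. f x = g x"
  shows "f = g"
proof -
  have op: "open {x. f x \<noteq> g x}"
    using f g by (rule open_Collect_neq)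
  have "{x. f x \<noteq> g x} \<in> null_sets lborel"
    using eq op by (simp add: AE_iff_null borel_open)
  then have "negligible {x. f x \<noteq> g x}"
    by (simp add: negligible_iff_null_sets null_sets_completionI)
  then have "{x. f x \<noteq> g x} = {}"
    using open_not_negligible[OF op] by blast
  then show ?thesis by auto
qed

lemma continuous_density_eq:
  assumes f: "continuous_on UNIV f" "\<And>x. 0 \<le> f x"
  shows "continuous_density (density lborel (\<lambda>x. ennreal (f x))) = f"
  unfolding continuous_density_def
proof (rule the_equality)
  fix g assume g: "continuous_on UNIV g \<and> (\<forall>x. 0 \<le> g x) \<and>
    density lborel (\<lambda>x. ennreal (f x)) = density lborel (\<lambda>x. ennreal (g x))"
  have meas: "f \<in> borel_measurable borel" "g \<in> borel_measurable borel"
    using f g by (auto intro: borel_measurable_continuous_onI)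
  then have "AE x in lborel. ennreal (f x) = ennreal (g x)"
    using g by (subst sigma_finite_measure.density_unique_iff[OF sigma_finite_lborel, symmetric]) auto
  then have "AE x in lborel. g x = f x"
    by eventually_elim (use f g in auto)
  then show "g = f"
    using f g continuous_AE_lborel_eq by blast
qed (use f in auto)

lemma TV_dist_density:
  assumes f [measurable]: "f \<in> borel_measurable borel" and "\<And>x. 0 \<le> f x"
    and g [measurable]: "g \<in> borel_measurable borel" and "\<And>x. 0 \<le> g x"
  shows "TV_dist (density lborel (\<lambda>x. ennreal (f x))) (density lborel (\<lambda>x. ennreal (g x)))
           = (\<integral>x. \<bar>f x - g x\<bar> \<partial>lborel)"
proof -
  have "AE x in lborel. ennreal (f x) = RN_deriv lborel (density lborel (\<lambda>x. ennreal (f x))) x"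
    "AE x in lborel. ennreal (g x) = RN_deriv lborel (density lborel (\<lambda>x. ennreal (g x))) x"
    by (auto intro!: sigma_finite_measure.RN_deriv_unique[OF sigma_finite_lborel])
  then have "AE x in lborel. \<bar>enn2real (RN_deriv lborel (density lborel (\<lambda>x. ennreal (f x))) x)
      - enn2real (RN_deriv lborel (density lborel (\<lambda>x. ennreal (g x))) x)\<bar> = \<bar>f x - g x\<bar>"
  proof eventually_elim
    case (elim x)
    then show ?case
      using assms(2)[of x] assms(4)[of x] by (simp flip: elim)
  qed
  then show ?thesis
    unfolding TV_dist_def by (intro integral_cong_AE) auto
qed

lemma KL_div_density:
  assumes "f \<in> borel_measurable borel" "\<And>x. 0 \<le> f x"
    and "g \<in> borel_measurable borel" "\<And>x. 0 < g x"
  shows "KL_div (density lborel (\<lambda>x. ennreal (f x))) (density lborel (\<lambda>x. ennreal (g x)))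
           = (\<integral>x. f x * ln (f x / g x) \<partial>lborel)"
  unfolding KL_div_def
  by (subst lborel.KL_density_density) (use assms in \<open>auto simp: log_def less_imp_le less_imp_neq[symmetric]\<close>)

lemma cdf_gumbel: "cdf gumbel x = exp (- exp (- x))"
proof -
  let ?d = "\<lambda>x. exp (- x - exp (- x)) :: real"
  let ?F = "\<lambda>x. exp (- exp (- x)) :: real"
  have D: "DERIV ?F y :> ?d y" for y
    by (auto intro!: derivative_eq_intros simp flip: exp_add)
  have lim: "((?F \<circ> real_of_ereal) \<longlongrightarrow> 0) (at_right (- \<infinity>))"
    unfolding ereal_tendsto_simps by real_asymp
  have lim': "((?F \<circ> real_of_ereal) \<longlongrightarrow> ?F x) (at_left (ereal x))"
    unfolding ereal_tendsto_simps by (intro tendsto_intros)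
  have cont: "isCont ?d y" for y
    by (intro continuous_intros)
  have si: "set_integrable lborel (einterval (-\<infinity>) x) ?d"
    and val: "(LBINT y=-\<infinity>..x. ?d y) = ?F x - 0"
    by (rule interval_integral_FTC_nonneg[OF _ D cont _ lim lim']; simp)+
  have ei: "einterval (-\<infinity>) (ereal x) = {..<x}"
    by (auto simp: einterval_def)
  have AE: "AE y in lborel. indicator {..<x} y * ?d y = indicator {..x} y * ?d y"
    using AE_lborel_singleton[of x] by eventually_elim (auto simp: indicator_def)
  have "emeasure gumbel {..x} = (\<integral>\<^sup>+y. ennreal (indicator {..<x} y * ?d y) \<partial>lborel)"
    unfolding gumbel_def
    by (subst emeasure_density)
       (auto intro!: nn_integral_cong_AE eventually_mono[OF AE] simp: indicator_def)
  also have "\<dots> = ennreal (\<integral>y. indicator {..<x} y * ?d y \<partial>lborel)"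
    using si by (intro nn_integral_eq_integral) (auto simp: set_integrable_def ei)
  also have "(\<integral>y. indicator {..<x} y * ?d y \<partial>lborel) = ?F x"
    using val by (simp add: interval_lebesgue_integral_def ei set_lebesgue_integral_def)
  finally show ?thesis
    by (simp add: cdf_def measure_def)
qed

end

theory Submission
  imports Defs "HOL-Real_Asymp.Real_Asymp"
begin

text \<open>
  Write \<open>L = ln n\<close>, \<open>c = ln (sqrt (4 \<pi> L))\<close> and \<open>\<delta> = c\<^sup>2 / (4 L)\<close>. The normalization turns every
  standard normal variable into one with mean \<open>c - 2 L\<close> and variance \<open>2 L\<close>, and completing the
  square shows that its density is exactly \<open>exp (-y) q(y) / n\<close> with
  \<open>q(y) = exp (-(y - c)\<^sup>2 / (4 L))\<close>. Hence the mean number of rescaled variables above \<open>x\<close> is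
  \<open>V(x) = \<integral>\<^sub>x\<^sup>\<infinity> exp (-y) q(y) dy\<close>, and the distribution function \<open>F\<close> of the maximum is close to
  \<open>exp (-V)\<close>. Since \<open>c \<rightarrow> \<infinity>\<close> while \<open>c\<^sup>2 / L \<rightarrow> 0\<close>, one has \<open>q = 1 - \<delta> (1 + o(1))\<close> on bounded sets,
  so that \<open>V(x) = (1 - \<delta> (1 + o(1))) exp (-x)\<close>. All other errors, such as \<open>1 / n\<close> and
  \<open>x c / L\<close>, are of smaller order than \<open>\<delta>\<close>.

  The function \<open>exp (-x) \<Lambda>(x)\<close> is the Gumbel density \<open>g\<close> itself. With \<open>h(x) = exp (-x) - 1\<close>, for
  which \<open>g' = h g\<close>, and with \<open>f = F'\<close>, the first order expansions are therefore
  \<open>F - \<Lambda> \<approx> \<delta> g\<close>, \<open>f - g \<approx> \<delta> h g\<close>, \<open>ln (f / g) \<approx> \<delta> h\<close> and \<open>(ln (f / g))' \<approx> - \<delta> exp (-x)\<close>.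
  The five constants are the corresponding functionals of \<open>g\<close>: \<open>sup g = 1 / e\<close>, \<open>\<integral> g = 1\<close>,
  \<open>\<integral> \<bar>h g\<bar> = 2 g(0) = 2 / e\<close>, and, at the second order, \<open>\<integral> h\<^sup>2 g / 2 = 1 / 2\<close> and
  \<open>\<integral> exp (-2 x) g / 4 = 1 / 2\<close>. Finally \<open>\<delta>\<close> is asymptotic to \<open>(ln (ln n))\<^sup>2 / (16 ln n)\<close>.

  The limits are exchanged with the integrals by dominated convergence. There is one
  function \<open>B\<close> (\<open>growth\<close> below), polynomial on the right and exponential on the left, with
  \<open>ln (f / g) \<le> \<delta> B\<close> and \<open>1 - f / g \<le> \<delta> B\<close> (\<open>log_ratio_le\<close>, \<open>one_minus_ratio_le\<close>). These two
  one-sided bounds control \<open>\<bar>f - g\<bar>\<close> by \<open>\<delta> B (f + g)\<close> and the entropy integrand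
  \<open>f ln (f / g) - f + g\<close>, which is nonnegative and has the same integral as
  \<open>f ln (f / g)\<close>, by \<open>\<delta>\<^sup>2 B\<^sup>2 (f + g)\<close>; a similar bound holds for the score
  (\<open>abs_density_diff_le\<close>, \<open>entropy_density_le\<close>, \<open>score_square_le\<close>). Using the entropy integrand in
  this form is essential: \<open>f ln (f / g)\<close> itself is only of order \<open>\<delta>\<close> pointwise. What remains is
  that \<open>f\<close> decays fast enough to absorb \<open>B\<^sup>2\<close>, uniformly in \<open>n\<close>. On the right \<open>f \<le> exp (-x)\<close>, and
  on the left \<open>rescaled_cdf_power_le\<close> gives decay of order \<open>exp (8 x)\<close>. The resulting common
  majorant is a multiple of \<open>exp (- \<bar>x\<bar> / 2)\<close> (\<open>domination\<close>).

  The pointwise limits then give total variation, entropy and Fisher information directly.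
  Convergence of \<open>(f - g) / \<delta>\<close> in \<open>L\<^sup>1\<close> yields convergence of \<open>(F - \<Lambda>) / \<delta>\<close> uniformly in \<open>x\<close>
  (\<open>cdf_expansion\<close>), hence the supremum distance, and integrating the majorant over a half-line
  bounds the tails of \<open>(F - \<Lambda>) / \<delta>\<close>, hence the Wasserstein distance.
\<close>

section \<open>Improper integrals and dominated convergence\<close>

text \<open>An antiderivative with a limit at infinity evaluates the improper integral, and the
  nonnegativity of the integrand makes it integrable. The three variants of this rule compute
  every explicit integral below.\<close>

lemma FTC_nonneg_above:
  fixes F f :: "real \<Rightarrow> real"
  assumes D: "\<And>y. (F has_real_derivative f y) (at y)" and cont: "continuous_on UNIV f"
    and nonneg: "\<And>y. x \<le> y \<Longrightarrow> 0 \<le> f y" and lim: "(F \<longlongrightarrow> B) at_top"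
  shows "has_bochner_integral lborel (\<lambda>y. indicator {x<..} y * f y) (B - F x)"
proof -
  have F: "isCont F y" for y using D DERIV_isCont by blast
  have lim1: "((F \<circ> real_of_ereal) \<longlongrightarrow> F x) (at_right (ereal x))"
    unfolding ereal_tendsto_simps using F[of x] by (auto simp: isCont_def intro: filterlim_at_split[THEN iffD1, THEN conjunct2])
  have lim2: "((F \<circ> real_of_ereal) \<longlongrightarrow> B) (at_left \<infinity>)"
    unfolding ereal_tendsto_simps by (rule lim)
  have c: "isCont f y" for y
    using cont by (simp add: continuous_on_eq_continuous_at)
  have si: "set_integrable lborel (einterval x \<infinity>) f"
    and val: "(LBINT y=ereal x..\<infinity>. f y) = B - F x"
    by (rule interval_integral_FTC_nonneg[OF _ D c _ lim1 lim2]; use nonneg in simp)+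
  have ei: "einterval (ereal x) \<infinity> = {x<..}"
    by (auto simp: einterval_def)
  show ?thesis
    using si val unfolding ei
    by (simp add: has_bochner_integral_iff set_integrable_def interval_lebesgue_integral_def ei set_lebesgue_integral_def)
qed

lemma FTC_nonneg_below:
  fixes F f :: "real \<Rightarrow> real"
  assumes D: "\<And>y. (F has_real_derivative f y) (at y)" and cont: "continuous_on UNIV f"
    and nonneg: "\<And>y. y \<le> x \<Longrightarrow> 0 \<le> f y" and lim: "(F \<longlongrightarrow> A) at_bot"
  shows "has_bochner_integral lborel (\<lambda>y. indicator {..x} y * f y) (F x - A)"
proof -
  have [measurable]: "f \<in> borel_measurable borel"
    using cont by (rule borel_measurable_continuous_onI)
  have F: "isCont F y" for y using D DERIV_isCont by blast
  have lim1: "((F \<circ> real_of_ereal) \<longlongrightarrow> F x) (at_left (ereal x))"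
    unfolding ereal_tendsto_simps using F[of x] by (auto simp: isCont_def intro: filterlim_at_split[THEN iffD1, THEN conjunct1])
  have lim2: "((F \<circ> real_of_ereal) \<longlongrightarrow> A) (at_right (-\<infinity>))"
    unfolding ereal_tendsto_simps by (rule lim)
  have c: "isCont f y" for y
    using cont by (simp add: continuous_on_eq_continuous_at)
  have si: "set_integrable lborel (einterval (-\<infinity>) x) f"
    and val: "(LBINT y=-\<infinity>..ereal x. f y) = F x - A"
    by (rule interval_integral_FTC_nonneg[OF _ D c _ lim2 lim1]; use nonneg in simp)+
  have ei: "einterval (-\<infinity>) (ereal x) = {..<x}"
    by (auto simp: einterval_def)
  have 1: "has_bochner_integral lborel (\<lambda>y. indicator {..<x} y * f y) (F x - A)"
    using si val unfolding ei
    by (simp add: has_bochner_integral_iff set_integrable_def interval_lebesgue_integral_def ei set_lebesgue_integral_def)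
  have AE: "AE y in lborel. indicator {..<x} y * f y = indicator {..x} y * f y"
    using AE_lborel_singleton[of x] by eventually_elim (auto simp: indicator_def)
  show ?thesis
    by (rule has_bochner_integralI_AE[OF 1 _ AE]) simp
qed

lemma FTC_nonneg_line:
  fixes F f :: "real \<Rightarrow> real"
  assumes D: "\<And>y. (F has_real_derivative f y) (at y)" and cont: "continuous_on UNIV f"
    and nonneg: "\<And>y. 0 \<le> f y" and bot: "(F \<longlongrightarrow> A) at_bot" and top: "(F \<longlongrightarrow> B) at_top"
  shows "has_bochner_integral lborel f (B - A)"
proof -
  have "has_bochner_integral lborel
     (\<lambda>y. indicator {..0} y * f y + indicator {0<..} y * f y) ((F 0 - A) + (B - F 0))"
    by (intro has_bochner_integral_add FTC_nonneg_above[OF D cont] FTC_nonneg_below[OF D cont])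
      (use assms in auto)
  also have "(\<lambda>y. indicator {..0} y * f y + indicator {0<..} y * f y) = f"
    by (auto simp: indicator_def)
  finally show ?thesis by simp
qed

lemma integrable_exp_neg_abs:
  assumes "0 < k"
  shows "integrable lborel (\<lambda>x::real. exp (- k * \<bar>x\<bar>))"
proof -
  have lim0: "((\<lambda>y. exp (k * y) / k) \<longlongrightarrow> 0) at_bot"
    using assms by real_asymp
  have 1: "has_bochner_integral lborel (\<lambda>y. indicator {..0} y * exp (k * y)) (exp (k * 0) / k - 0)"
    by (rule FTC_nonneg_below[OF _ _ _ lim0])
       (use assms in \<open>auto intro!: derivative_eq_intros continuous_intros\<close>)
  have lim: "((\<lambda>y. - exp (- k * y) / k) \<longlongrightarrow> 0) at_top"
    using assms by real_asymp
  have 2: "has_bochner_integral lborel (\<lambda>y. indicator {0<..} y * exp (- k * y)) (0 - (- exp (- k * 0) / k))"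
    by (rule FTC_nonneg_above[OF _ _ _ lim])
       (use assms in \<open>auto intro!: derivative_eq_intros continuous_intros\<close>)
  have "integrable lborel (\<lambda>y. indicator {..0} y * exp (k * y) + indicator {0<..} y * exp (- k * y))"
    using 1 2 by (auto simp: has_bochner_integral_iff)
  also have "(\<lambda>y. indicator {..0} y * exp (k * y) + indicator {0<..} y * exp (- k * y)) = (\<lambda>x. exp (- k * \<bar>x\<bar>))"
    by (auto simp: indicator_def abs_if)
  finally show ?thesis .
qed

text \<open>All estimates hold only for large indices, so the majorant is required eventually.\<close>

lemma dominated_convergence_eventually:
  fixes s :: "nat \<Rightarrow> 'a \<Rightarrow> real"
  assumes f: "f \<in> borel_measurable M"
    and w: "integrable M w" and lim: "\<And>x. (\<lambda>n. s n x) \<longlonglongrightarrow> f x"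
    and bound: "eventually (\<lambda>n. s n \<in> borel_measurable M \<and> (\<forall>x. \<bar>s n x\<bar> \<le> w x)) sequentially"
  shows "integrable M f" and "(\<lambda>n. integral\<^sup>L M (s n)) \<longlonglongrightarrow> integral\<^sup>L M f"
proof -
  obtain N where N: "\<And>n. n \<ge> N \<Longrightarrow> s n \<in> borel_measurable M" "\<And>n x. n \<ge> N \<Longrightarrow> \<bar>s n x\<bar> \<le> w x"
    using bound unfolding eventually_sequentially by blast
  have lim': "AE x in M. (\<lambda>n. s (n + N) x) \<longlonglongrightarrow> f x"
    using lim by (intro AE_I2 LIMSEQ_ignore_initial_segment)
  have bd: "AE x in M. norm (s (n + N) x) \<le> w x" for n
    by (intro AE_I2) (simp add: N)
  show "integrable M f"
    by (rule integrable_dominated_convergence[OF f _ w lim' bd]) (simp add: N)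
  have "(\<lambda>n. integral\<^sup>L M (s (n + N))) \<longlonglongrightarrow> integral\<^sup>L M f"
    by (rule integral_dominated_convergence[OF f _ w lim' bd]) (simp add: N)
  then show "(\<lambda>n. integral\<^sup>L M (s n)) \<longlonglongrightarrow> integral\<^sup>L M f"
    by (rule LIMSEQ_offset)
qed

lemma DERIV_integral_atMost:
  fixes p :: "real \<Rightarrow> real"
  assumes cont: "continuous_on UNIV p" and int: "integrable lborel p"
  shows "((\<lambda>x. \<integral>y. indicator {..x} y * p y \<partial>lborel) has_real_derivative p x) (at x)"
proof -
  let ?G = "\<lambda>x. \<integral>y. indicator {..x} y * p y \<partial>lborel"
  have [simp]: "integrable lborel (\<lambda>y. indicator A y * p y)" if "A \<in> sets borel" for A
    using integrable_mult_indicator[OF _ int, of A] that by simp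
  have G: "?G z = ?G (x - 1) + integral {x - 1..z} p" if "x - 1 \<le> z" for z
  proof -
    have "?G z = (\<integral>y. indicator {..x - 1} y * p y + indicator {x - 1<..z} y * p y \<partial>lborel)"
      using that by (intro Bochner_Integration.integral_cong) (auto simp: indicator_def)
    also have "\<dots> = ?G (x - 1) + (\<integral>y. indicator {x - 1<..z} y * p y \<partial>lborel)"
      by (rule Bochner_Integration.integral_add) auto
    also have "(\<integral>y. indicator {x - 1<..z} y * p y \<partial>lborel) = (\<integral>y. indicator {x - 1..z} y * p y \<partial>lborel)"
    proof (rule integral_cong_AE)
      show "AE y in lborel. indicator {x - 1<..z} y * p y = indicator {x - 1..z} y * p y"
        using AE_lborel_singleton[of "x - 1"] by eventually_elim (auto simp: indicator_def)
    qed (use int in measurable)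
    also have "\<dots> = integral {x - 1..z} p"
      using set_borel_integral_eq_integral(2)[of "{x - 1..z}" p]
      by (simp add: set_integrable_def set_lebesgue_integral_def)
    finally show ?thesis .
  qed
  have "((\<lambda>z. integral {x - 1..z} p) has_vector_derivative p x) (at x within {x - 1..x + 1})"
    by (rule integral_has_vector_derivative) (auto intro: continuous_on_subset[OF cont])
  then have "((\<lambda>z. ?G (x - 1) + integral {x - 1..z} p) has_real_derivative p x) (at x)"
    by (auto simp: at_within_Icc_at has_real_derivative_iff_has_vector_derivative intro!: derivative_eq_intros)
  moreover have "eventually (\<lambda>z. ?G z = ?G (x - 1) + integral {x - 1..z} p) (nhds x)"
    by (rule eventually_mono[OF eventually_nhds_in_open[of "{x - 1<..}" x]]) (auto intro: G)
  ultimately show ?thesis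
    by (subst DERIV_cong_ev[OF refl _ refl]) auto
qed

lemma has_bochner_integral_le:
  fixes u v :: "'a \<Rightarrow> real"
  assumes "has_bochner_integral M u a" "has_bochner_integral M v b" "\<And>x. u x \<le> v x"
  shows "a \<le> b"
  using integral_mono[of M u v] assms by (auto simp: has_bochner_integral_iff)

lemma has_integral_exp_tail:
  "has_bochner_integral lborel (\<lambda>y. indicator {x<..} y * exp (- y)) (exp (- x :: real))"
proof -
  have "((\<lambda>y::real. - exp (- y)) \<longlongrightarrow> 0) at_top" by real_asymp
  then have "has_bochner_integral lborel (\<lambda>y. indicator {x<..} y * exp (- y)) (0 - - exp (- x))"
    by (intro FTC_nonneg_above) (auto intro!: derivative_eq_intros continuous_intros)
  then show ?thesis by simp
qed

lemma has_integral_quadratic_exp_tail: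
  "has_bochner_integral lborel (\<lambda>y. indicator {x<..} y * (exp (- y) * (1 + y\<^sup>2)))
     (exp (- x) * (x\<^sup>2 + 2 * x + 3 :: real))"
proof -
  have "((\<lambda>y::real. - (exp (- y) * (y\<^sup>2 + 2 * y + 3))) \<longlongrightarrow> 0) at_top" by real_asymp
  then have "has_bochner_integral lborel (\<lambda>y. indicator {x<..} y * (exp (- y) * (1 + y\<^sup>2)))
      (0 - - (exp (- x) * (x\<^sup>2 + 2 * x + 3)))"
  proof (rule FTC_nonneg_above[rotated 3])
    show "((\<lambda>y. - (exp (- y) * (y\<^sup>2 + 2 * y + 3))) has_real_derivative exp (- y) * (1 + y\<^sup>2)) (at y)" for y :: real
      by (auto intro!: derivative_eq_intros simp: algebra_simps power2_eq_square)
  qed (auto intro!: continuous_intros)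
  then show ?thesis by simp
qed

lemma exp_minus_le:
  assumes "0 \<le> (t::real)"
  shows "exp (- t) \<le> 1 - t + t\<^sup>2"
proof -
  have "exp (- t) = 1 / exp t" by (simp add: exp_minus divide_inverse)
  also have "\<dots> \<le> 1 / (1 + t)"
    using assms exp_ge_add_one_self[of t] by (intro divide_left_mono) (auto intro!: mult_pos_pos)
  also have "\<dots> \<le> 1 - t + t\<^sup>2"
  proof -
    have "0 \<le> t ^ 3" using assms by simp
    then have "1 \<le> (1 - t + t\<^sup>2) * (1 + t)"
      by (simp add: power2_eq_square power3_eq_cube algebra_simps)
    then show ?thesis using assms by (simp add: divide_le_eq)
  qed
  finally show ?thesis .
qed

section \<open>The maximum of independent, identically distributed variables\<close>

lemma measure_density_lborel:
  fixes p :: "real \<Rightarrow> real"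
  assumes int: "integrable lborel p" and nonneg: "\<And>x. 0 \<le> p x" and A: "A \<in> sets borel"
  shows "measure (density lborel (\<lambda>x. ennreal (p x))) A = (\<integral>y. indicator A y * p y \<partial>lborel)"
proof -
  have [measurable]: "p \<in> borel_measurable borel" using int by auto
  have i: "integrable lborel (\<lambda>y. indicator A y * p y)"
    using integrable_mult_indicator[OF _ int, of A] A by simp
  have "emeasure (density lborel (\<lambda>x. ennreal (p x))) A = (\<integral>\<^sup>+y. ennreal (indicator A y * p y) \<partial>lborel)"
    using A by (subst emeasure_density) (auto intro!: nn_integral_cong simp: indicator_def)
  also have "\<dots> = ennreal (\<integral>y. indicator A y * p y \<partial>lborel)"
    by (rule nn_integral_eq_integral[OF i]) (simp add: nonneg)
  finally show ?thesis
    by (simp add: measure_def nonneg)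
qed

lemma prob_space_density_lborel:
  fixes p :: "real \<Rightarrow> real"
  assumes int: "has_bochner_integral lborel p 1" and nonneg: "\<And>x. 0 \<le> p x"
  shows "real_distribution (density lborel (\<lambda>x. ennreal (p x)))"
proof -
  have i: "integrable lborel p" and v: "integral\<^sup>L lborel p = 1"
    using int by (auto simp: has_bochner_integral_iff)
  have [measurable]: "p \<in> borel_measurable borel" using i by auto
  have "prob_space (density lborel (\<lambda>x. ennreal (p x)))"
  proof
    have "emeasure (density lborel (\<lambda>x. ennreal (p x))) (space lborel) = (\<integral>\<^sup>+y. ennreal (p y) \<partial>lborel)"
      by (subst emeasure_density) (auto intro!: nn_integral_cong)
    then show "emeasure (density lborel (\<lambda>x. ennreal (p x))) (space (density lborel (\<lambda>x. ennreal (p x)))) = 1"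
      using nn_integral_eq_integral[OF i] nonneg v by simp
  qed
  then show ?thesis
    by (simp add: real_distribution_def real_distribution_axioms_def)
qed

lemma density_of_smooth_cdf:
  fixes F f :: "real \<Rightarrow> real"
  assumes D: "\<And>y. (F has_real_derivative f y) (at y)" and cont: "continuous_on UNIV f"
    and nonneg: "\<And>y. 0 \<le> f y" and bot: "(F \<longlongrightarrow> 0) at_bot" and top: "(F \<longlongrightarrow> 1) at_top"
  shows "real_distribution (density lborel (\<lambda>x. ennreal (f x)))"
    and "cdf (density lborel (\<lambda>x. ennreal (f x))) = F"
proof -
  have 1: "has_bochner_integral lborel f 1"
    using FTC_nonneg_line[OF assms] by simp
  then show "real_distribution (density lborel (\<lambda>x. ennreal (f x)))"
    using nonneg by (rule prob_space_density_lborel)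
  show "cdf (density lborel (\<lambda>x. ennreal (f x))) = F"
  proof
    fix x
    have "(\<integral>y. indicator {..x} y * f y \<partial>lborel) = F x"
      using FTC_nonneg_below[OF D cont nonneg bot, of x] by (auto dest: has_bochner_integral_integral_eq)
    then show "cdf (density lborel (\<lambda>x. ennreal (f x))) x = F x"
      using 1 by (simp add: cdf_def measure_density_lborel has_bochner_integral_iff nonneg)
  qed
qed

lemma (in prob_space) distributed_cdf:
  fixes p :: "real \<Rightarrow> real"
  assumes dist: "distributed M lborel X (\<lambda>x. ennreal (p x))"
    and int: "integrable lborel p" and nonneg: "\<And>x. 0 \<le> p x"
  shows "prob {\<omega> \<in> space M. X \<omega> \<le> x} = (\<integral>y. indicator {..x} y * p y \<partial>lborel)"
proof -
  have [measurable]: "X \<in> borel_measurable M" using dist by (auto simp: distributed_def)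
  have "prob {\<omega> \<in> space M. X \<omega> \<le> x} = measure (distr M lborel X) {..x}"
    by (subst measure_distr) (auto intro!: arg_cong[where f=prob])
  also have "distr M lborel X = density lborel (\<lambda>x. ennreal (p x))"
    using dist by (simp add: distributed_def)
  finally show ?thesis
    by (simp add: measure_density_lborel[OF int nonneg])
qed

text \<open>By independence the maximum has distribution function \<open>G ^ n\<close>. This function is smooth and
  its derivative is the claimed density, so the two laws agree because their distribution
  functions do.\<close>

lemma (in prob_space) distr_Max_iid:
  fixes X :: "nat \<Rightarrow> 'a \<Rightarrow> real" and p :: "real \<Rightarrow> real"
  assumes n: "1 \<le> n" and indep: "indep_vars (\<lambda>_. borel) X {1..n}"
    and dist: "\<And>i. i \<in> {1..n} \<Longrightarrow> distributed M lborel (X i) (\<lambda>x. ennreal (p x))"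
    and cont: "continuous_on UNIV p" and nonneg: "\<And>x. 0 \<le> p x"
    and int: "has_bochner_integral lborel p 1"
  defines "G \<equiv> \<lambda>x. \<integral>y. indicator {..x} y * p y \<partial>lborel"
  shows "distr M borel (\<lambda>\<omega>. MAX i\<in>{1..n}. X i \<omega>)
           = density lborel (\<lambda>x. ennreal (real n * p x * G x ^ (n - 1)))" (is "?D = ?E")
    and "cdf (distr M borel (\<lambda>\<omega>. MAX i\<in>{1..n}. X i \<omega>)) = (\<lambda>x. G x ^ n)"
    and "(\<lambda>\<omega>. MAX i\<in>{1..n}. X i \<omega>) \<in> borel_measurable M"
proof -
  let ?Y = "\<lambda>\<omega>. MAX i\<in>{1..n}. X i \<omega>"
  have ne: "{1..n} \<noteq> {}" using n by auto
  have i: "integrable lborel p" using int by (simp add: has_bochner_integral_iff)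
  have X [measurable]: "X i \<in> borel_measurable M" if "i \<in> {1..n}" for i
    using dist[OF that] by (simp add: distributed_def)
  show Y [measurable]: "?Y \<in> borel_measurable M"
    by (rule borel_measurable_Max) (auto intro: X)
  have cdfY: "cdf ?D x = G x ^ n" for x
  proof -
    have "cdf ?D x = prob {\<omega> \<in> space M. ?Y \<omega> \<le> x}"
      by (simp add: cdf_def measure_distr vimage_def Int_def conj_commute)
    also have "{\<omega> \<in> space M. ?Y \<omega> \<le> x} = (\<Inter>i\<in>{1..n}. X i -` {..x} \<inter> space M)"
      using ne by (subst Max_le_iff) auto
    also have "prob \<dots> = (\<Prod>i\<in>{1..n}. prob (X i -` {..x} \<inter> space M))"
      by (rule indep_varsD[OF indep ne]) auto
    also have "\<dots> = (\<Prod>i\<in>{1..n}. G x)"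
    proof (rule prod.cong[OF refl])
      fix j assume "j \<in> {1..n}"
      from distributed_cdf[OF dist[OF this] i nonneg]
      show "prob (X j -` {..x} \<inter> space M) = G x"
        by (simp add: G_def vimage_def Int_def conj_commute)
    qed
    finally show ?thesis by simp
  qed

  show cdfY': "cdf ?D = (\<lambda>x. G x ^ n)" using cdfY by auto
  interpret R: real_distribution "density lborel (\<lambda>x. ennreal (p x))"
    using int nonneg by (rule prob_space_density_lborel)
  have cdfG: "cdf (density lborel (\<lambda>x. ennreal (p x))) = G"
    by (auto simp: cdf_def G_def measure_density_lborel[OF i nonneg])
  have G0: "(G \<longlongrightarrow> 0) at_bot" and G1: "(G \<longlongrightarrow> 1) at_top"
    using R.cdf_lim_at_bot R.cdf_lim_at_top_prob by (simp_all add: cdfG)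
  have DG: "(G has_real_derivative p y) (at y)" for y
    unfolding G_def by (rule DERIV_integral_atMost[OF cont i])
  have Gn0: "G y \<ge> 0" for y unfolding G_def by (rule Bochner_Integration.integral_nonneg) (simp add: nonneg)
  have Gc: "continuous_on UNIV G"
    by (rule DERIV_continuous_on[OF has_field_derivative_at_within[OF DG]])
  have DGn: "((\<lambda>x. G x ^ n) has_real_derivative real n * p y * G y ^ (n - 1)) (at y)" for y
    using DERIV_power[OF DG[of y], of n] by (simp add: ac_simps)
  have fc: "continuous_on UNIV (\<lambda>x. real n * p x * G x ^ (n - 1))"
    by (intro continuous_intros cont Gc)
  have f0: "0 \<le> real n * p y * G y ^ (n - 1)" for y
    by (simp add: nonneg Gn0)
  have lim0: "((\<lambda>x. G x ^ n) \<longlongrightarrow> 0) at_bot"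
    using tendsto_power[OF G0, of n] n by (simp add: power_0_left)
  have lim1: "((\<lambda>x. G x ^ n) \<longlongrightarrow> 1) at_top"
    using tendsto_power[OF G1, of n] by simp
  have "real_distribution ?E" "cdf ?E = (\<lambda>x. G x ^ n)"
    by (rule density_of_smooth_cdf[OF DGn fc f0 lim0 lim1])+
  moreover have "real_distribution ?D"
    by (rule real_distribution_distr) measurable
  ultimately show "?D = ?E"
    using cdfY' by (intro cdf_unique) auto
qed

section \<open>The rescaled normal variables\<close>

text \<open>The two normalizing sequences satisfy \<open>a\<^sub>n b\<^sub>n = 2 ln n - log_shift n\<close>.\<close>

definition log_shift :: "nat \<Rightarrow> real" where
  "log_shift n = ln (sqrt (4 * pi * ln (real n)))"

text \<open>The value of \<open>(y - c)\<^sup>2 / (4 ln n)\<close> at \<open>y = 0\<close>: the common first order error of the tail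
  intensity on bounded sets, to which all five distances are compared.\<close>

definition rate :: "nat \<Rightarrow> real" where
  "rate n = (log_shift n)\<^sup>2 / (4 * ln (real n))"

text \<open>The factor by which the normal tail intensity at level \<open>n\<close> differs from its limit
  \<open>exp (- y)\<close>.\<close>

definition damping :: "nat \<Rightarrow> real \<Rightarrow> real" where
  "damping n y = exp (- (y - log_shift n)\<^sup>2 / (4 * ln (real n)))"

text \<open>The density of a single rescaled variable \<open>a\<^sub>n (X\<^sub>i - b\<^sub>n)\<close>, see
  \<open>rescaled_density_normal\<close>.\<close>

definition rescaled_density :: "nat \<Rightarrow> real \<Rightarrow> real" where
  "rescaled_density n y = exp (- y) * damping n y / real n"

definition rescaled_cdf :: "nat \<Rightarrow> real \<Rightarrow> real" where
  "rescaled_cdf n x = (\<integral>y. indicator {..x} y * rescaled_density n y \<partial>lborel)"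

definition max_density :: "nat \<Rightarrow> real \<Rightarrow> real" where
  "max_density n x = exp (- x) * damping n x * rescaled_cdf n x ^ (n - 1)"

text \<open>Completing the square: the constant \<open>ln (sqrt (4 \<pi> ln n))\<close> in \<open>b\<^sub>n\<close> is exactly what turns the
  Gaussian prefactor into \<open>1 / n\<close>.\<close>

lemma rescaled_density_normal:
  assumes "2 \<le> n"
  shows "rescaled_density n y = normal_density (- (norm_a n * norm_b n)) (norm_a n) y"
proof -
  define L where "L = ln (real n)"
  define c where "c = log_shift n"
  have L: "L > 0" using assms by (simp add: L_def)
  have n: "real n = exp L" using assms by (simp add: L_def)
  have a2: "(norm_a n)\<^sup>2 = 2 * L" using L by (simp add: norm_a_def L_def)
  have ec: "sqrt (4 * pi * L) = exp c"
    using L by (simp add: c_def log_shift_def L_def[symmetric])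
  have ab: "norm_a n * norm_b n = 2 * L - c"
    using L by (simp add: norm_a_def norm_b_def L_def[symmetric] c_def log_shift_def right_diff_distrib)
  have "normal_density (- (norm_a n * norm_b n)) (norm_a n) y
      = exp (- (y + (2 * L - c))\<^sup>2 / (4 * L)) / exp c"
  proof -
    have eqs: "y - - (2 * L - c) = y + (2 * L - c)" "2 * (2 * L) = 4 * L" "2 * pi * (2 * L) = 4 * pi * L"
      by (simp_all add: mult.assoc)
    show ?thesis
      unfolding normal_density_def a2 ab eqs ec by simp
  qed
  also have "\<dots> = exp (- (y + (2 * L - c))\<^sup>2 / (4 * L) - c)"
    by (simp add: exp_diff)
  also have "- (y + (2 * L - c))\<^sup>2 / (4 * L) - c = - y + (- (y - c)\<^sup>2 / (4 * L)) - L"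
    using L by (simp add: field_simps power2_eq_square)
  also have "exp \<dots> = rescaled_density n y"
    unfolding rescaled_density_def damping_def L_def[symmetric] c_def[symmetric] exp_add exp_diff
    by (simp flip: n)
  finally show ?thesis by simp
qed

lemma rescaled_density_nonneg: "0 \<le> rescaled_density n y"
  by (simp add: rescaled_density_def damping_def)

lemma continuous_on_damping: "continuous_on A (damping n)"
  unfolding damping_def divide_inverse by (intro continuous_intros)

lemma continuous_on_rescaled_density: "continuous_on A (rescaled_density n)"
  unfolding rescaled_density_def divide_inverse by (intro continuous_intros continuous_on_damping)

lemma has_bochner_integral_rescaled_density:
  assumes "2 \<le> n"
  shows "has_bochner_integral lborel (rescaled_density n) 1"
proof -
  have "0 < norm_a n" using assms by (simp add: norm_a_def)
  then show ?thesis
    unfolding rescaled_density_normal[OF assms, abs_def]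
    by (simp add: has_bochner_integral_iff)
qed

lemma
  fixes M :: "'a measure" and X :: "nat \<Rightarrow> 'a \<Rightarrow> real"
  assumes "prob_space M"
    and indep: "prob_space.indep_vars M (\<lambda>_. borel) X {1..}"
    and dist: "\<And>i. i \<ge> 1 \<Longrightarrow> distributed M lborel (X i) std_normal_density"
    and n: "2 \<le> n"
  shows distr_normalized_max:
      "distr M borel (normalized_max X n) = density lborel (\<lambda>x. ennreal (max_density n x))" (is ?A)
    and cdf_normalized_max: "cdf (distr M borel (normalized_max X n)) x = rescaled_cdf n x ^ n" (is ?B)
    and measurable_normalized_max: "normalized_max X n \<in> borel_measurable M" (is ?C)
proof -
  interpret prob_space M by fact
  have a: "0 < norm_a n" using n by (simp add: norm_a_def)
  define Z where "Z i \<omega> = norm_a n * (X i \<omega> - norm_b n)" for i \<omega>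
  have Y: "normalized_max X n = (\<lambda>\<omega>. MAX i\<in>{1..n}. Z i \<omega>)"
  proof
    fix \<omega>
    have "mono (\<lambda>x. norm_a n * (x - norm_b n))"
      using a by (auto intro!: monoI mult_left_mono)
    from mono_Max_commute[OF this, of "(\<lambda>i. X i \<omega>) ` {1..n}"]
    show "normalized_max X n \<omega> = (MAX i\<in>{1..n}. Z i \<omega>)"
      using n by (simp add: normalized_max_def Z_def image_image)
  qed
  have iZ: "indep_vars (\<lambda>_. borel) Z {1..n}"
    unfolding Z_def
    by (rule indep_vars_compose2[OF indep_vars_subset[OF indep]]) auto
  have dZ: "distributed M lborel (Z i) (\<lambda>x. ennreal (rescaled_density n x))" if "i \<in> {1..n}" for i
  proof -
    have "distributed M lborel (\<lambda>\<omega>. - (norm_a n * norm_b n) + norm_a n * X i \<omega>)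
       (normal_density (- (norm_a n * norm_b n) + norm_a n * 0) (\<bar>norm_a n\<bar> * 1))"
      by (rule normal_density_affine) (use a dist[of i] that in auto)
    then show ?thesis
      using a by (simp add: Z_def[abs_def] rescaled_density_normal[OF n] algebra_simps)
  qed
  have f: "real n * rescaled_density n x * rescaled_cdf n x ^ (n - 1) = max_density n x" for x
    using n by (simp add: max_density_def rescaled_density_def)
  note * = distr_Max_iid[OF _ iZ dZ continuous_on_rescaled_density rescaled_density_nonneg
        has_bochner_integral_rescaled_density[OF n], folded rescaled_cdf_def Y, unfolded f]
  show ?A ?B ?C using * n by auto
qed

section \<open>Bounds at a fixed level\<close>

definition gumbel_density :: "real \<Rightarrow> real" where
  "gumbel_density x = exp (- x - exp (- x))"

definition mean_exceedances :: "nat \<Rightarrow> real \<Rightarrow> real" where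
  "mean_exceedances n x = real n * (1 - rescaled_cdf n x)"

text \<open>The logarithm of the density of the normalized maximum relative to the Gumbel density,
  see \<open>max_density_eq\<close>.\<close>

definition log_ratio :: "nat \<Rightarrow> real \<Rightarrow> real" where
  "log_ratio n x = - (x - log_shift n)\<^sup>2 / (4 * ln (real n)) + real (n - 1) * ln (rescaled_cdf n x) + exp (- x)"

text \<open>The derivative of \<open>log_ratio\<close>.\<close>

definition relative_score :: "nat \<Rightarrow> real \<Rightarrow> real" where
  "relative_score n x = - (x - log_shift n) / (2 * ln (real n))
     + exp (- x) * ((1 - 1 / real n) * damping n x / rescaled_cdf n x - 1)"

text \<open>A single majorant for all relative errors divided by the rate. The errors grow
  quadratically on the right, from \<open>(y - c)\<^sup>2\<close>, and like \<open>exp (- 2 * x)\<close> on the left, from the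
  second order term in \<open>ln (1 - V / n)\<close>.\<close>

definition growth :: "real \<Rightarrow> real" where
  "growth x = 6 * (1 + x\<^sup>2) * (1 + exp (- x))\<^sup>2"

lemma growth_ge_1: "1 \<le> growth x"
proof -
  have "1 * 1 \<le> (1 + x\<^sup>2) * (1 + exp (- x))\<^sup>2"
    by (intro mult_mono) (auto simp: one_le_power)
  then show ?thesis unfolding growth_def mult.assoc by linarith
qed

text \<open>The four error expressions that occur below, in the form in which they arise.\<close>

lemma growth_bounds:
  fixes x :: real
  defines "E \<equiv> exp (- x)"
  shows "E * (2 * (x\<^sup>2 + 2 * x + 3) + 1) \<le> growth x"
    and "2 * (1 + x\<^sup>2) + 2 * E\<^sup>2 \<le> growth x"
    and "2 * E \<le> growth x"
    and "2 * (1 + \<bar>x\<bar>) + E * (2 * (1 + x\<^sup>2) + 1 + E) \<le> growth x"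
proof -
  have E: "0 < E" by (simp add: E_def)
  define s where "s = 1 + x\<^sup>2"
  have s: "1 \<le> s" by (simp add: s_def)
  have g: "growth x = 6 * s + 12 * (s * E) + 6 * (s * E\<^sup>2)"
    unfolding growth_def E_def[symmetric] s_def[symmetric] by (simp add: power2_eq_square algebra_simps)
  have sE: "E \<le> s * E" "E\<^sup>2 \<le> s * E\<^sup>2" "0 \<le> s * E" "0 \<le> s * E\<^sup>2"
    using s E by (auto intro!: mult_right_mono simp: mult_le_cancel_right1)
  have a: "2 * \<bar>x\<bar> \<le> s"
    using zero_le_power2[of "\<bar>x\<bar> - 1"] by (simp add: s_def power2_eq_square algebra_simps)
  have "9 * s - (2 * (x\<^sup>2 + 2 * x + 3) + 1) = 5 * x\<^sup>2 + 2 * (x - 1)\<^sup>2"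
    by (simp add: s_def power2_eq_square algebra_simps)
  then have "2 * (x\<^sup>2 + 2 * x + 3) + 1 \<le> 9 * s"
    using zero_le_power2[of x] zero_le_power2[of "x - 1"] by linarith
  then have "E * (2 * (x\<^sup>2 + 2 * x + 3) + 1) \<le> E * (9 * s)"
    using E by (intro mult_left_mono) auto
  also have "\<dots> \<le> growth x" using sE s g by (simp add: algebra_simps)
  finally show "E * (2 * (x\<^sup>2 + 2 * x + 3) + 1) \<le> growth x" .
  show "2 * (1 + x\<^sup>2) + 2 * E\<^sup>2 \<le> growth x" "2 * E \<le> growth x"
    using sE s g unfolding s_def[symmetric] by linarith+
  have "2 * (1 + \<bar>x\<bar>) + E * (2 * (1 + x\<^sup>2) + 1 + E) \<le> 3 * s + 2 * (s * E) + E + E\<^sup>2"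
    using a s unfolding s_def[symmetric] by (simp add: algebra_simps power2_eq_square)
  also have "\<dots> \<le> growth x" using sE s g by linarith
  finally show "2 * (1 + \<bar>x\<bar>) + E * (2 * (1 + x\<^sup>2) + 1 + E) \<le> growth x" .
qed

lemma damping_pos: "0 < damping n y"
  by (simp add: damping_def)

lemma gumbel_density_pos: "0 < gumbel_density x"
  by (simp add: gumbel_density_def)

text \<open>The level is large enough for all estimates below; this holds eventually, see
  \<open>eventually_extreme_level\<close>. The bound \<open>11 \<le> n\<close> makes the exponent \<open>n - 3\<close> at least 8, which is
  the decay rate needed on the left.\<close>

locale extreme_level =
  fixes n :: nat
  assumes n_ge: "11 \<le> n"
    and shift_ge: "1 \<le> log_shift n"
    and inverse_le_rate: "1 / real n \<le> rate n"
    and rate_le: "rate n \<le> 1 / 2"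
begin

abbreviation "L \<equiv> ln (real n)"
abbreviation "c \<equiv> log_shift n"
abbreviation "\<delta> \<equiv> rate n"
abbreviation "q \<equiv> damping n"
abbreviation "G \<equiv> rescaled_cdf n"
abbreviation "V \<equiv> mean_exceedances n"
abbreviation "f \<equiv> max_density n"
abbreviation "g \<equiv> gumbel_density"
abbreviation "B \<equiv> growth"

lemma L_pos: "0 < L" using n_ge by simp

lemma rate_pos: "0 < \<delta>"
  using L_pos shift_ge by (simp add: rate_def)

lemma inverse_L_le: "1 / (4 * L) \<le> \<delta>"
proof -
  have "1 \<le> c\<^sup>2" using shift_ge by (simp add: one_le_power)
  then show ?thesis using L_pos by (simp add: rate_def divide_right_mono)
qed

lemma quadratic_exponent_le: "(y - c)\<^sup>2 / (4 * L) \<le> y\<^sup>2 / (2 * L) + 2 * \<delta>"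
proof -
  have "(y - c)\<^sup>2 \<le> 2 * y\<^sup>2 + 2 * c\<^sup>2"
    using zero_le_power2[of "y + c"] by (simp add: power2_eq_square algebra_simps)
  then have "(y - c)\<^sup>2 / (4 * L) \<le> (2 * y\<^sup>2 + 2 * c\<^sup>2) / (4 * L)"
    using L_pos by (intro divide_right_mono) auto
  also have "\<dots> = y\<^sup>2 / (2 * L) + 2 * \<delta>"
    using L_pos by (simp add: rate_def field_simps)
  finally show ?thesis .
qed

text \<open>Since \<open>c \<ge> 1\<close>, the term \<open>y\<^sup>2 / L\<close> is at most a multiple of the rate times \<open>y\<^sup>2\<close>.\<close>

lemma quadratic_exponent_le_rate: "(y - c)\<^sup>2 / (4 * L) \<le> 2 * \<delta> * (1 + y\<^sup>2)"
proof -
  have "y\<^sup>2 / (2 * L) = 2 * y\<^sup>2 * (1 / (4 * L))" using L_pos by (simp add: field_simps)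
  also have "\<dots> \<le> 2 * y\<^sup>2 * \<delta>" using inverse_L_le by (intro mult_left_mono) auto
  finally show ?thesis using quadratic_exponent_le[of y] by (simp add: algebra_simps)
qed

lemma damping_le_1: "q y \<le> 1"
  using L_pos by (simp add: damping_def)

lemma one_minus_damping_le: "1 - q y \<le> 2 * \<delta> * (1 + y\<^sup>2)"
  using exp_ge_add_one_self[of "- (y - c)\<^sup>2 / (4 * L)"] quadratic_exponent_le_rate[of y]
  by (simp add: damping_def)

lemma has_integral_rescaled_density: "has_bochner_integral lborel (rescaled_density n) 1"
  using n_ge by (intro has_bochner_integral_rescaled_density) simp

lemma DERIV_rescaled_cdf: "(G has_real_derivative rescaled_density n x) (at x)"
  unfolding rescaled_cdf_def[abs_def]
  by (rule DERIV_integral_atMost) (use has_integral_rescaled_density in \<open>auto simp: continuous_on_rescaled_density has_bochner_integral_iff\<close>)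

lemma rescaled_cdf_nonneg: "0 \<le> G x"
  unfolding rescaled_cdf_def by (rule Bochner_Integration.integral_nonneg) (simp add: rescaled_density_nonneg)

lemma rescaled_cdf_strict_mono: "x < y \<Longrightarrow> G x < G y"
  by (rule DERIV_pos_imp_increasing)
     (use DERIV_rescaled_cdf n_ge in \<open>auto intro!: exI simp: rescaled_density_def damping_pos\<close>)

lemma rescaled_cdf_pos: "0 < G x"
  using rescaled_cdf_nonneg[of "x - 1"] rescaled_cdf_strict_mono[of "x - 1" x] by simp

lemma mean_exceedances_antimono: "x \<le> y \<Longrightarrow> V y \<le> V x"
  using rescaled_cdf_strict_mono[of x y] by (cases "x = y") (auto simp: mean_exceedances_def intro!: mult_left_mono)

text \<open>The factor \<open>n\<close> cancels the prefactor \<open>1 / n\<close> of the density, so that the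
  tail of the rescaled variables is compared with the tail \<open>exp (- x)\<close> of the limiting
  intensity under the integral sign.\<close>

lemma has_integral_mean_exceedances:
  "has_bochner_integral lborel (\<lambda>y. indicator {x<..} y * (exp (- y) * q y)) (V x)"
proof -
  have "has_bochner_integral lborel (\<lambda>y. indicator {..x} y * rescaled_density n y) (G x)"
    unfolding rescaled_cdf_def has_bochner_integral_iff
    using integrable_mult_indicator[of "{..x}" lborel "rescaled_density n"] has_integral_rescaled_density by (auto simp: has_bochner_integral_iff)
  from has_bochner_integral_diff[OF has_integral_rescaled_density this]
  have "has_bochner_integral lborel (\<lambda>y. rescaled_density n y - indicator {..x} y * rescaled_density n y) (1 - G x)" .
  from has_bochner_integral_mult_right[OF this, of "real n"]
  have "has_bochner_integral lborel (\<lambda>y. real n * (rescaled_density n y - indicator {..x} y * rescaled_density n y)) (V x)"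
    by (simp add: mean_exceedances_def)
  also have "(\<lambda>y. real n * (rescaled_density n y - indicator {..x} y * rescaled_density n y)) =
      (\<lambda>y. indicator {x<..} y * (exp (- y) * q y))"
    using n_ge by (auto simp: indicator_def rescaled_density_def)
  finally show ?thesis .
qed

lemma mean_exceedances_nonneg: "0 \<le> V x"
  unfolding has_bochner_integral_integral_eq[OF has_integral_mean_exceedances, symmetric]
  by (rule Bochner_Integration.integral_nonneg) (simp add: damping_pos less_imp_le)

lemma rescaled_cdf_le_1: "G x \<le> 1"
  using mean_exceedances_nonneg[of x] n_ge by (simp add: mean_exceedances_def zero_le_mult_iff)

lemma has_integral_tail_defect:
  "has_bochner_integral lborel (\<lambda>y. indicator {x<..} y * (exp (- y) * (1 - q y))) (exp (- x) - V x)"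
proof -
  have "has_bochner_integral lborel
     (\<lambda>y. indicator {x<..} y * exp (- y) - indicator {x<..} y * (exp (- y) * q y)) (exp (- x) - V x)"
    by (intro has_bochner_integral_diff has_integral_exp_tail has_integral_mean_exceedances)
  then show ?thesis by (simp add: algebra_simps)
qed

lemma mean_exceedances_le: "V x \<le> exp (- x)"
proof -
  have "0 \<le> (\<integral>y. indicator {x<..} y * (exp (- y) * (1 - q y)) \<partial>lborel)"
    by (rule Bochner_Integration.integral_nonneg) (simp add: damping_le_1)
  then show ?thesis
    using has_bochner_integral_integral_eq[OF has_integral_tail_defect] by simp
qed

lemma tail_defect_le: "exp (- x) - V x \<le> \<delta> * (exp (- x) * (2 * (x\<^sup>2 + 2 * x + 3)))"
proof -
  note has_integral_quadratic_exp_tail[of x]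
  from has_bochner_integral_mult_right[OF this, of "2 * \<delta>"]
  have "has_bochner_integral lborel (\<lambda>y. 2 * \<delta> * (indicator {x<..} y * (exp (- y) * (1 + y\<^sup>2))))
      (\<delta> * (exp (- x) * (2 * (x\<^sup>2 + 2 * x + 3))))"
    by (simp add: algebra_simps)
  moreover have "indicator {x<..} y * (exp (- y) * (1 - q y)) \<le> 2 * \<delta> * (indicator {x<..} y * (exp (- y) * (1 + y\<^sup>2)))" for y
    using mult_left_mono[OF one_minus_damping_le[of y], of "exp (- y)"] by (auto simp: indicator_def algebra_simps)
  ultimately show ?thesis
    by (intro has_bochner_integral_le[OF has_integral_tail_defect])
qed

lemma one_minus_rescaled_cdf: "1 - G x = V x / real n"
  using n_ge by (simp add: mean_exceedances_def)

lemma one_minus_rescaled_cdf_le: "1 - G x \<le> \<delta> * exp (- x)"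
proof -
  have "V x / real n \<le> exp (- x) * (1 / real n)" using mean_exceedances_le[of x] by (simp add: divide_right_mono)
  also have "\<dots> \<le> exp (- x) * \<delta>" using inverse_le_rate by (intro mult_left_mono) auto
  finally show ?thesis by (simp add: one_minus_rescaled_cdf mult.commute)
qed

text \<open>From \<open>ln G \<le> G - 1\<close>; replacing \<open>n - 1\<close> by \<open>n\<close> costs \<open>V x / n\<close>.\<close>

lemma log_cdf_upper: "real (n - 1) * ln (G x) \<le> - V x + exp (- x) / real n"
proof -
  have "real (n - 1) * ln (G x) \<le> real (n - 1) * (G x - 1)"
    using ln_le_minus_one[OF rescaled_cdf_pos[of x]] by (intro mult_left_mono) auto
  also have "\<dots> = - V x + V x / real n"
    using n_ge by (simp add: mean_exceedances_def of_nat_diff field_simps)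
  also have "V x / real n \<le> exp (- x) / real n" using mean_exceedances_le[of x] by (simp add: divide_right_mono)
  finally show ?thesis by simp
qed

text \<open>With \<open>t = 1 - G x = V x / n\<close> this is \<open>- ln (1 - t) \<le> t + 2 * t\<^sup>2\<close>, which holds up to
  \<open>t = 1 / 2\<close>; the quadratic term is an error of order \<open>1 / n\<close>.\<close>

lemma log_cdf_lower:
  assumes "1 / 2 \<le> G x"
  shows "- V x - 2 * (exp (- x))\<^sup>2 / real n \<le> real (n - 1) * ln (G x)"
proof -
  define t where "t = 1 - G x"
  have t: "0 \<le> t" "t \<le> 1/2" using rescaled_cdf_le_1[of x] assms by (auto simp: t_def)
  have "- ln (G x) = ln (1 / G x)" using rescaled_cdf_pos[of x] by (simp add: ln_div)
  also have "\<dots> \<le> 1 / G x - 1" using rescaled_cdf_pos[of x] by (intro ln_le_minus_one) auto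
  also have "\<dots> \<le> t + 2 * t\<^sup>2"
  proof -
    have "1 \<le> (1 + t + 2 * t\<^sup>2) * (1 - t)"
    proof -
      have "0 \<le> t\<^sup>2 * (1 - 2 * t)" using t by simp
      also have "\<dots> = (1 + t + 2 * t\<^sup>2) * (1 - t) - 1" by (simp add: power2_eq_square algebra_simps)
      finally show ?thesis by simp
    qed
    then show ?thesis using t by (simp add: t_def field_simps)
  qed
  finally have "real (n - 1) * (- ln (G x)) \<le> real n * (t + 2 * t\<^sup>2)"
    using t by (intro order.trans[OF mult_left_mono mult_right_mono]) auto
  also have "\<dots> = V x + 2 * (V x)\<^sup>2 / real n"
    using n_ge by (simp add: t_def one_minus_rescaled_cdf) (simp add: field_simps power2_eq_square)
  also have "\<dots> \<le> V x + 2 * (exp (- x))\<^sup>2 / real n"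
    using mean_exceedances_le[of x] mean_exceedances_nonneg[of x]
    by (intro add_mono divide_right_mono mult_left_mono power_mono) auto
  finally show ?thesis by simp
qed

lemma max_density_eq: "f x = g x * exp (log_ratio n x)"
proof -
  have "G x ^ (n - 1) = exp (real (n - 1) * ln (G x))"
    using rescaled_cdf_pos[of x] by (simp add: exp_of_nat_mult)
  then show ?thesis
    by (simp add: max_density_def gumbel_density_def log_ratio_def damping_def flip: exp_add)
qed

lemma max_density_pos: "0 < f x"
  by (simp add: max_density_eq gumbel_density_pos)

lemma log_ratio_le: "log_ratio n x \<le> \<delta> * B x"
proof -
  have "exp (- x) / real n \<le> exp (- x) * \<delta>"
    using mult_left_mono[OF inverse_le_rate, of "exp (- x)"] by simp
  moreover have "- (x - c)\<^sup>2 / (4 * L) \<le> 0" using L_pos by simp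
  ultimately have "log_ratio n x \<le> \<delta> * (exp (- x) * (2 * (x\<^sup>2 + 2 * x + 3) + 1))"
    using log_cdf_upper[of x] tail_defect_le[of x] by (simp add: log_ratio_def algebra_simps)
  also have "\<dots> \<le> \<delta> * B x"
    using growth_bounds(1)[of x] rate_pos by (intro mult_left_mono) auto
  finally show ?thesis .
qed

text \<open>The lower bound on the density ratio is stated for \<open>1 - exp (log_ratio n x)\<close> rather than
  for \<open>- log_ratio n x\<close> because the former never exceeds 1. This settles the region far on the
  left, where \<open>G\<close> is not close to 1 and its logarithm is hard to control.\<close>

lemma one_minus_ratio_le: "1 - exp (log_ratio n x) \<le> \<delta> * B x"
proof (cases "1 / 2 \<le> G x")
  case True
  have "2 * (exp (- x))\<^sup>2 / real n \<le> 2 * (exp (- x))\<^sup>2 * \<delta>"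
    using mult_left_mono[OF inverse_le_rate, of "2 * (exp (- x))\<^sup>2"] by simp
  then have "- log_ratio n x \<le> \<delta> * (2 * (1 + x\<^sup>2) + 2 * (exp (- x))\<^sup>2)"
    using log_cdf_lower[OF True] quadratic_exponent_le_rate[of x] mean_exceedances_le[of x]
    by (simp add: log_ratio_def algebra_simps)
  also have "\<dots> \<le> \<delta> * B x"
    using growth_bounds(2)[of x] rate_pos by (intro mult_left_mono) auto
  finally show ?thesis using exp_ge_add_one_self[of "log_ratio n x"] by linarith
next
  case False
  \<comment> \<open>Fewer than half of the variables are below \<open>x\<close> on average, which forces \<open>\<delta> * B x \<ge> 1\<close>.\<close>
  then have "1 / 2 \<le> \<delta> * exp (- x)" using one_minus_rescaled_cdf_le[of x] by simp
  then have "1 \<le> \<delta> * (2 * exp (- x))" by simp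
  also have "\<dots> \<le> \<delta> * B x"
    using growth_bounds(3)[of x] rate_pos by (intro mult_left_mono) auto
  finally have "1 \<le> \<delta> * B x" .
  then show ?thesis using exp_gt_zero[of "log_ratio n x"] by linarith
qed

text \<open>Where \<open>f \<ge> g\<close>, the difference is at most \<open>f\<close> times the logarithm of the ratio;
  elsewhere it is \<open>g\<close> times one minus the ratio.\<close>

lemma abs_density_diff_le: "\<bar>f x - g x\<bar> \<le> \<delta> * B x * (f x + g x)"
proof -
  define l where "l = log_ratio n x"
  define b where "b = \<delta> * B x"
  have b: "l \<le> b" "1 - exp l \<le> b" "0 \<le> b"
    using log_ratio_le[of x] one_minus_ratio_le[of x] rate_pos growth_ge_1[of x] by (auto simp: l_def b_def)
  have f: "f x = g x * exp l" by (simp add: max_density_eq l_def)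
  have g: "0 < g x" by (rule gumbel_density_pos)
  have f0: "0 < f x" by (rule max_density_pos)
  have "f x - g x \<le> b * f x"
  proof -
    have "f x - g x = f x * (1 - exp (- l))" by (simp add: f algebra_simps flip: exp_add)
    also have "\<dots> \<le> f x * b" using exp_ge_add_one_self[of "- l"] b f0 by (intro mult_left_mono) auto
    finally show ?thesis by (simp add: mult.commute)
  qed
  moreover have "g x - f x \<le> b * g x"
  proof -
    have "g x - f x = g x * (1 - exp l)" by (simp add: f algebra_simps)
    also have "\<dots> \<le> g x * b" using b g by (intro mult_left_mono) auto
    finally show ?thesis by (simp add: mult.commute)
  qed
  moreover have "0 \<le> b * f x" "0 \<le> b * g x" using b g f0 by auto
  ultimately show ?thesis unfolding b_def[symmetric] distrib_left by linarith
qed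

text \<open>With \<open>r = f / g\<close> the expression is \<open>g (r ln r - r + 1)\<close>, which vanishes to second order
  at \<open>r = 1\<close>. For \<open>r \<ge> 1\<close> it is at most \<open>g r (ln r)\<^sup>2\<close>, and for \<open>r \<le> 1\<close> at most
  \<open>g (1 - r)\<^sup>2\<close>, so one-sided control of the ratio suffices.\<close>

lemma entropy_density_le:
  fixes x defines "k \<equiv> f x * log_ratio n x - f x + g x"
  shows "0 \<le> k" and "k \<le> (\<delta> * B x)\<^sup>2 * (f x + g x)"
proof -
  define l where "l = log_ratio n x"
  define b where "b = \<delta> * B x"
  have b: "l \<le> b" "1 - exp l \<le> b" "0 \<le> b"
    using log_ratio_le[of x] one_minus_ratio_le[of x] rate_pos growth_ge_1[of x] by (auto simp: l_def b_def)
  have f: "f x = g x * exp l" by (simp add: max_density_eq l_def)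
  have g: "0 < g x" by (rule gumbel_density_pos)
  have f0: "0 < f x" by (rule max_density_pos)
  have k1: "k = f x * (l - 1 + exp (- l))"
    unfolding k_def l_def[symmetric] f by (simp add: algebra_simps flip: exp_add)
  show "0 \<le> k"
    unfolding k1 using exp_ge_add_one_self[of "- l"] f0 by (intro mult_nonneg_nonneg) auto
  have "k \<le> b\<^sup>2 * (f x + g x)"
  proof (cases "0 \<le> l")
    case True
    have "exp (- l) \<le> 1 - l + l\<^sup>2" using True by (rule exp_minus_le)
    moreover have "l\<^sup>2 \<le> b\<^sup>2" using True b by (intro power_mono) auto
    ultimately have "k \<le> f x * b\<^sup>2"
      unfolding k1 using f0 by (intro mult_left_mono) auto
    also have "\<dots> \<le> b\<^sup>2 * (f x + g x)" using g by (simp add: distrib_left mult.commute)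
    finally show ?thesis .
  next
    case False
    have "k = g x * (exp l * l - exp l + 1)"
      unfolding k_def l_def[symmetric] f by (simp add: algebra_simps)
    also have "\<dots> \<le> g x * (1 - exp l)\<^sup>2"
    proof (intro mult_left_mono)
      have "exp l * l \<le> exp l * (exp l - 1)"
        using exp_ge_add_one_self[of l] by (intro mult_left_mono exp_ge_zero) linarith
      then show "exp l * l - exp l + 1 \<le> (1 - exp l)\<^sup>2"
        by (simp add: power2_eq_square algebra_simps)
    qed (use g in auto)
    also have "\<dots> \<le> g x * b\<^sup>2"
      using False b g by (intro mult_left_mono power_mono) auto
    also have "\<dots> \<le> b\<^sup>2 * (f x + g x)" using f0 by (simp add: distrib_left mult.commute)
    finally show ?thesis .
  qed
  then show "k \<le> (\<delta> * B x)\<^sup>2 * (f x + g x)" by (simp add: b_def)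
qed

lemma DERIV_log_ratio: "(log_ratio n has_real_derivative relative_score n x) (at x)"
proof -
  have ln: "((\<lambda>x. ln (G x)) has_real_derivative rescaled_density n x / G x) (at x)"
    using DERIV_ln_divide[OF rescaled_cdf_pos] DERIV_rescaled_cdf DERIV_chain2 by fastforce
  have sq: "((\<lambda>x. - (x - c)\<^sup>2 / (4 * L)) has_real_derivative - (2 * (x - c)) / (4 * L)) (at x)"
    using L_pos by (auto intro!: derivative_eq_intros simp: field_simps)
  have "((\<lambda>x. - (x - c)\<^sup>2 / (4 * L) + real (n - 1) * ln (G x) + exp (- x)) has_real_derivative
      - (2 * (x - c)) / (4 * L) + real (n - 1) * (rescaled_density n x / G x) - exp (- x)) (at x)"
    by (rule DERIV_add[OF DERIV_add[OF sq DERIV_cmult[OF ln]], of "\<lambda>x. exp (- x)" "- exp (- x)", THEN DERIV_cong])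
       (auto intro!: derivative_eq_intros)
  also have "- (2 * (x - c)) / (4 * L) + real (n - 1) * (rescaled_density n x / G x) - exp (- x) = relative_score n x"
    using n_ge L_pos rescaled_cdf_pos[of x] unfolding relative_score_def rescaled_density_def
    by (simp add: of_nat_diff divide_simps) (simp add: algebra_simps)
  finally show ?thesis unfolding log_ratio_def[abs_def] .
qed

text \<open>The factor \<open>G\<close> clears the denominator of the score, so that its bound does not involve a lower
  bound for \<open>G\<close> on the left.\<close>

lemma relative_score_bound: "\<bar>relative_score n x * G x\<bar> \<le> \<delta> * B x"
proof -
  let ?u = "- (x - c) / (2 * L)" and ?v = "(1 - 1 / real n) * q x - G x"
  have G: "0 < G x" "G x \<le> 1" by (rule rescaled_cdf_pos rescaled_cdf_le_1)+
  have q: "0 < q x" "q x \<le> 1" by (rule damping_pos damping_le_1)+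
  have "relative_score n x * G x = ?u * G x + exp (- x) * ?v"
    using G by (simp add: relative_score_def field_simps)
  then have "\<bar>relative_score n x * G x\<bar> \<le> \<bar>?u * G x\<bar> + \<bar>exp (- x) * ?v\<bar>" by linarith
  also have "\<bar>?u * G x\<bar> \<le> \<bar>?u\<bar> * 1"
    unfolding abs_mult using G by (intro mult_left_mono) auto
  also have "\<bar>?u\<bar> * 1 \<le> 2 * \<delta> * (1 + \<bar>x\<bar>)"
  proof -
    have "\<bar>x - c\<bar> \<le> c\<^sup>2 * (1 + \<bar>x\<bar>)"
    proof -
      have "\<bar>x - c\<bar> \<le> \<bar>x\<bar> + c" using shift_ge by linarith
      moreover have "\<bar>x\<bar> \<le> c\<^sup>2 * \<bar>x\<bar>" using mult_right_mono[OF one_le_power[OF shift_ge, of 2] abs_ge_zero[of x]] by simp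
      moreover have "c \<le> c\<^sup>2" using shift_ge by (simp add: power2_eq_square)
      ultimately show ?thesis unfolding distrib_left by linarith
    qed
    then have "\<bar>x - c\<bar> / (2 * L) \<le> c\<^sup>2 * (1 + \<bar>x\<bar>) / (2 * L)"
      using L_pos by (intro divide_right_mono) auto
    also have "\<dots> = 2 * \<delta> * (1 + \<bar>x\<bar>)" using L_pos by (simp add: rate_def field_simps)
    finally show ?thesis using L_pos by (simp add: abs_minus_commute)
  qed
  also have "\<bar>exp (- x) * ?v\<bar> \<le> exp (- x) * (2 * \<delta> * (1 + x\<^sup>2) + \<delta> + \<delta> * exp (- x))"
  proof -
    have "?v = (q x - 1) - q x * (1 / real n) + (1 - G x)" by (simp add: algebra_simps)
    moreover have "q x * (1 / real n) \<le> 1 * \<delta>"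
      using q inverse_le_rate by (intro mult_mono) auto
    moreover have "0 \<le> q x * (1 / real n)" using q by simp
    ultimately have "\<bar>?v\<bar> \<le> 2 * \<delta> * (1 + x\<^sup>2) + \<delta> + \<delta> * exp (- x)"
      using one_minus_damping_le[of x] one_minus_rescaled_cdf_le[of x] q G by linarith
    then show ?thesis by (simp add: abs_mult)
  qed
  finally have "\<bar>relative_score n x * G x\<bar> \<le> \<delta> * (2 * (1 + \<bar>x\<bar>) + exp (- x) * (2 * (1 + x\<^sup>2) + 1 + exp (- x)))"
    by (simp add: algebra_simps)
  also have "\<dots> \<le> \<delta> * B x"
    using growth_bounds(4)[of x] rate_pos by (intro mult_left_mono) auto
  finally show ?thesis .
qed

lemma max_density_le: "f x \<le> exp (- x) * G x ^ (n - 3)"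
proof -
  have "f x \<le> exp (- x) * 1 * G x ^ (n - 3)"
    unfolding max_density_def
    using rescaled_cdf_pos[of x] rescaled_cdf_le_1[of x] damping_le_1[of x] damping_pos[of n x]
    by (intro mult_mono power_decreasing) auto
  then show ?thesis by simp
qed

text \<open>The square of the score costs two powers of \<open>G\<close>, which the factor \<open>G ^ (n - 1)\<close> of
  the density provides; this is where the exponent \<open>n - 3\<close> comes from.\<close>

lemma score_square_le: "(relative_score n x)\<^sup>2 * f x \<le> (\<delta> * B x)\<^sup>2 * (exp (- x) * G x ^ (n - 3))"
proof -
  have "G x ^ (n - 1) = G x ^ (n - 3) * (G x)\<^sup>2"
  proof -
    have "n - 1 = (n - 3) + 2" using n_ge by simp
    then show ?thesis by (simp only: power_add)
  qed
  then have "(relative_score n x)\<^sup>2 * f x = (relative_score n x * G x)\<^sup>2 * (exp (- x) * q x * G x ^ (n - 3))"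
    by (simp add: max_density_def power_mult_distrib)
  also have "\<dots> \<le> (\<delta> * B x)\<^sup>2 * (exp (- x) * 1 * G x ^ (n - 3))"
    using relative_score_bound[of x] rescaled_cdf_pos[of x] damping_le_1[of x] damping_pos[of n x]
    by (intro mult_mono mult_nonneg_nonneg) (auto simp: abs_le_square_iff[symmetric] abs_le_iff intro!: power_mono)
  finally show ?thesis by simp
qed

end

section \<open>Uniform decay in the tails\<close>

context extreme_level
begin

text \<open>Only the contribution of \<open>(x, x + 1]\<close> is kept. As long as \<open>- x \<le> L\<close>, the Gaussian
  damping uses up at most half of the exponent \<open>- x\<close>.\<close>

lemma mean_exceedances_ge:
  assumes "x \<le> 0" "- x \<le> L"
  shows "exp (- x / 2 - 2) \<le> V x"
proof -
  have "x\<^sup>2 \<le> - x * L"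
    using mult_left_mono[OF assms(2), of "- x"] assms(1) by (simp add: power2_eq_square)
  then have "x\<^sup>2 / (2 * L) \<le> - x / 2" using L_pos by (simp add: field_simps)
  then have e: "(x - c)\<^sup>2 / (4 * L) \<le> - x / 2 + 1"
    using quadratic_exponent_le[of x] rate_le by simp
  have le: "exp (- x / 2 - 2) \<le> exp (- y) * q y" if "x < y" "y \<le> x + 1" for y
  proof -
    have "\<bar>y - c\<bar> \<le> \<bar>x - c\<bar>" using that assms shift_ge by linarith
    then have "(y - c)\<^sup>2 \<le> (x - c)\<^sup>2" by (simp add: abs_le_square_iff)
    then have "(y - c)\<^sup>2 / (4 * L) \<le> - x / 2 + 1"
      using e L_pos by (meson divide_right_mono order.trans less_imp_le mult_pos_pos zero_less_numeral)
    then show ?thesis using that by (simp add: damping_def flip: exp_add)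
  qed
  have "has_bochner_integral lborel (\<lambda>y. indicator {x<..x + 1} y * exp (- x / 2 - 2)) (1 * exp (- x / 2 - 2))"
  proof (intro has_bochner_integral_mult_left)
    show "has_bochner_integral lborel (indicator {x<..x + 1}) (1::real)"
      using has_bochner_integral_real_indicator[of "{x<..x + 1}" lborel] by (simp add: measure_def)
  qed
  then have "1 * exp (- x / 2 - 2) \<le> V x"
    by (rule has_bochner_integral_le[OF _ has_integral_mean_exceedances])
       (use le damping_pos in \<open>auto simp: indicator_def less_imp_le\<close>)
  then show ?thesis by simp
qed

text \<open>Beyond \<open>- 8 * L\<close> the Gaussian factor dominates: there
  \<open>(y - c)\<^sup>2 / (4 L) \<ge> - 2 y\<close>, so \<open>exp (- y) * q y\<close> is at most \<open>exp y\<close>.\<close>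

lemma rescaled_cdf_le_exp:
  assumes "x \<le> - 8 * L"
  shows "G x \<le> exp x"
proof -
  have le: "exp (- y) * q y \<le> exp y" if "y \<le> x" for y
  proof -
    have y: "y \<le> - 8 * L" "y \<le> 0" using that assms L_pos by auto
    then have "- 8 * L * y \<le> y\<^sup>2"
      using mult_right_mono_neg[OF y(1,2)] by (simp add: power2_eq_square)
    also have "\<dots> \<le> (y - c)\<^sup>2"
      using y shift_ge by (simp add: abs_le_square_iff[symmetric])
    finally have "- 2 * y \<le> (y - c)\<^sup>2 / (4 * L)" using L_pos by (simp add: field_simps)
    then show ?thesis by (simp add: damping_def flip: exp_add)
  qed
  have "((\<lambda>y::real. exp y) \<longlongrightarrow> 0) at_bot" by real_asymp
  then have "has_bochner_integral lborel (\<lambda>y. indicator {..x} y * exp y) (exp x - 0)"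
    by (intro FTC_nonneg_below) (auto intro!: derivative_eq_intros continuous_intros)
  moreover have "has_bochner_integral lborel (\<lambda>y. indicator {..x} y * rescaled_density n y) (G x)"
    unfolding rescaled_cdf_def has_bochner_integral_iff
    using integrable_mult_indicator[of "{..x}" lborel "rescaled_density n"] has_integral_rescaled_density by (auto simp: has_bochner_integral_iff)
  moreover have "indicator {..x} y * rescaled_density n y \<le> indicator {..x} y * exp y" for y
  proof -
    have "rescaled_density n y \<le> exp y" if "y \<le> x"
    proof -
      have "rescaled_density n y \<le> exp (- y) * q y / 1"
        unfolding rescaled_density_def using n_ge damping_pos[of n y] by (intro divide_left_mono) auto
      then show ?thesis using le[OF that] by simp
    qed
    then show ?thesis by (auto simp: indicator_def)
  qed
  ultimately show ?thesis using has_bochner_integral_le by fastforce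
qed

lemma rescaled_cdf_power_le_tail: "G x ^ (n - 3) \<le> exp (- V x / 2)"
proof -
  have "G x ^ (n - 3) = exp (real (n - 3) * ln (G x))"
    using rescaled_cdf_pos[of x] by (simp add: exp_of_nat_mult)
  also have "real (n - 3) * ln (G x) \<le> real (n - 3) * (- (V x / real n))"
    using ln_le_minus_one[OF rescaled_cdf_pos[of x]] one_minus_rescaled_cdf[of x] by (intro mult_left_mono) auto
  also have "\<dots> = - (real (n - 3) / real n) * V x" by simp
  also have "\<dots> \<le> - (1 / 2) * V x"
    using n_ge mean_exceedances_nonneg[of x] by (intro mult_right_mono) (auto simp: field_simps of_nat_diff)
  finally show ?thesis by simp
qed

text \<open>Up to distance \<open>8 * L\<close> from the origin the mean number of exceedances is exponentially
  large in \<open>- x\<close>, hence the power is doubly exponentially small. Still farther to the left,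
  for fixed \<open>n\<close>, the mean number of exceedances stays below \<open>n\<close> and this argument breaks
  down, but there the single factor \<open>G\<close> is already small.\<close>

lemma rescaled_cdf_power_le:
  assumes "x \<le> 0"
  shows "G x ^ (n - 3) \<le> max (exp (8 * x)) (exp (- (exp (- 2) / 2) * exp (1 / 16 * - x)))"
proof (cases "x \<le> - 8 * L")
  case True
  have "G x ^ (n - 3) \<le> exp x ^ (n - 3)"
    using rescaled_cdf_le_exp[OF True] rescaled_cdf_nonneg[of x] by (rule power_mono)
  also have "\<dots> = exp (real (n - 3) * x)" by (simp add: exp_of_nat_mult)
  also have "\<dots> \<le> exp (8 * x)"
    using n_ge assms by (simp add: mult_right_mono_neg)
  finally show ?thesis by simp
next
  case False
  have "exp (- x / 16 - 2) \<le> V x"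
  proof (cases "- x \<le> L")
    case True
    then show ?thesis using mean_exceedances_ge[OF assms True] assms
      by (elim order.trans[rotated]) simp
  next
    case 2: False
    have "exp (- x / 16 - 2) \<le> exp (- (- L) / 2 - 2)" using False by simp
    also have "\<dots> \<le> V (- L)" using L_pos by (intro mean_exceedances_ge) auto
    also have "\<dots> \<le> V x" using 2 by (intro mean_exceedances_antimono) auto
    finally show ?thesis .
  qed
  moreover have "exp (- x / 16 - 2) = exp (- 2) * exp (1 / 16 * - x)" by (simp flip: exp_add)
  ultimately have "exp (- V x / 2) \<le> exp (- (exp (- 2) / 2) * exp (1 / 16 * - x))" by simp
  then show ?thesis using rescaled_cdf_power_le_tail[of x] by linarith
qed

end

text \<open>A quadratic lower bound for the inner exponential already beats every linear exponent.\<close>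

lemma double_exp_decay:
  fixes a b k t :: real
  assumes "0 < a" "0 < b" "0 \<le> t"
  shows "exp (- a * exp (b * t)) \<le> exp (k\<^sup>2 / (2 * a * b\<^sup>2)) * exp (- k * t)"
proof -
  have "1 + b * t + (b * t)\<^sup>2 / 2 \<le> exp (b * t)"
    using assms by (intro exp_lower_Taylor_quadratic) simp
  then have "(b * t)\<^sup>2 / 2 \<le> exp (b * t)" using assms mult_nonneg_nonneg[of b t] by linarith
  then have "a * ((b * t)\<^sup>2 / 2) \<le> a * exp (b * t)" using assms by (intro mult_left_mono) auto
  moreover have "k * t \<le> a * ((b * t)\<^sup>2 / 2) + k\<^sup>2 / (2 * a * b\<^sup>2)"
  proof -
    \<comment> \<open>The constant is the maximum over \<open>t\<close> of \<open>k * t - a * (b * t)\<^sup>2 / 2\<close>.\<close>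
    have "0 \<le> (a * b\<^sup>2 * t - k)\<^sup>2 / (2 * a * b\<^sup>2)" using assms by simp
    also have "\<dots> = a * ((b * t)\<^sup>2 / 2) + k\<^sup>2 / (2 * a * b\<^sup>2) - k * t"
      using assms by (simp add: power2_eq_square field_simps)
    finally show ?thesis by simp
  qed
  ultimately show ?thesis by (simp flip: exp_add)
qed

text \<open>The weight \<open>exp (- x) * exp (8 * min x 0)\<close> is the decay of the densities, and on the left
  \<open>(growth x)\<^sup>2\<close> grows like \<open>exp (- 4 * x)\<close> up to a power of \<open>x\<close>, which leaves room to
  spare.\<close>

lemma growth_square_le: "exp (- x) * exp (8 * min x 0) * (growth x)\<^sup>2 \<le> 3096\<^sup>2 * exp (- (1 / 2) * \<bar>x\<bar>)"
proof -
  have 1: "1 + x\<^sup>2 \<le> 129 * exp (\<bar>x\<bar> / 8)"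
  proof -
    have "1 + \<bar>x\<bar> / 8 + (\<bar>x\<bar> / 8)\<^sup>2 / 2 \<le> exp (\<bar>x\<bar> / 8)"
      by (intro exp_lower_Taylor_quadratic) simp
    then have "128 + 16 * \<bar>x\<bar> + x\<^sup>2 \<le> 128 * exp (\<bar>x\<bar> / 8)" by (simp add: power2_eq_square)
    moreover have "1 \<le> exp (\<bar>x\<bar> / 8)" by simp
    ultimately show ?thesis by linarith
  qed
  have 2: "1 + exp (- x) \<le> 2 * exp (- min x 0)" by (simp add: min_def)
  \<comment> \<open>The constant is \<open>3096 = 6 * 129 * 2\<^sup>2\<close>.\<close>
  have "growth x \<le> 6 * (129 * exp (\<bar>x\<bar> / 8)) * (2 * exp (- min x 0))\<^sup>2"
    unfolding growth_def by (intro mult_mono power_mono 1 2 mult_left_mono) auto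
  also have "\<dots> = 3096 * exp (\<bar>x\<bar> / 8 + 2 * (- min x 0))"
    by (simp only: power_mult_distrib exp_add exp_double[symmetric]) (simp add: power2_eq_square)
  finally have "(growth x)\<^sup>2 \<le> (3096 * exp (\<bar>x\<bar> / 8 + 2 * (- min x 0)))\<^sup>2"
    using growth_ge_1[of x] by (intro power_mono) auto
  also have "\<dots> = 3096\<^sup>2 * exp (\<bar>x\<bar> / 4 - 4 * min x 0)"
    by (simp only: power_mult_distrib exp_double[symmetric]) simp
  finally have "exp (- x) * exp (8 * min x 0) * (growth x)\<^sup>2
      \<le> exp (- x) * exp (8 * min x 0) * (3096\<^sup>2 * exp (\<bar>x\<bar> / 4 - 4 * min x 0))"
    by (intro mult_left_mono) auto
  also have "\<dots> = 3096\<^sup>2 * exp (- x + 8 * min x 0 + (\<bar>x\<bar> / 4 - 4 * min x 0))"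
    by (simp only: exp_add mult_ac)
  also have "\<dots> \<le> 3096\<^sup>2 * exp (- (1 / 2) * \<bar>x\<bar>)"
    by (intro mult_left_mono) (auto simp: min_def abs_if)
  finally show ?thesis .
qed

lemma uniform_domination:
  obtains C where "0 < C"
    and "\<And>n x. extreme_level n \<Longrightarrow>
      (growth x)\<^sup>2 * (exp (- x) * rescaled_cdf n x ^ (n - 3) + gumbel_density x) \<le> C * exp (- (1 / 2) * \<bar>x\<bar>)"
proof -
  define C1 where "C1 = exp (8\<^sup>2 / (2 * (exp (- 2) / 2) * (1 / 16 :: real)\<^sup>2))"
  define C2 where "C2 = exp (8\<^sup>2 / (2 * 1 * (1::real)\<^sup>2))"
  have C1: "1 \<le> C1" "1 \<le> C2" by (simp_all add: C1_def C2_def)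
  have G: "rescaled_cdf n x ^ (n - 3) \<le> C1 * exp (8 * min x 0)" if "extreme_level n" for n x
  proof -
    interpret extreme_level n by fact
    show ?thesis
    proof (cases "x \<le> 0")
      case True
      have "exp (- (exp (- 2) / 2) * exp (1 / 16 * - x)) \<le> C1 * exp (- 8 * - x)"
        unfolding C1_def using True by (intro double_exp_decay) auto
      then have "exp (- (exp (- 2) / 2) * exp (1 / 16 * - x)) \<le> C1 * exp (8 * x)" by simp
      moreover have "1 * exp (8 * x) \<le> C1 * exp (8 * x)" using C1 by (intro mult_right_mono) auto
      ultimately have "rescaled_cdf n x ^ (n - 3) \<le> C1 * exp (8 * x)"
        using rescaled_cdf_power_le[OF True, unfolded le_max_iff_disj] by linarith
      then show ?thesis using True by (simp add: min_def)
    next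
      case False
      then show ?thesis
        using power_le_one[OF rescaled_cdf_nonneg rescaled_cdf_le_1, of x "n - 3"] C1 by (simp add: min_def)
    qed
  qed
  have g: "gumbel_density x \<le> exp (- x) * (C2 * exp (8 * min x 0))" for x
  proof -
    have "exp (- exp (- x)) \<le> C2 * exp (8 * min x 0)"
    proof (cases "x \<le> 0")
      case True
      have "exp (- 1 * exp (1 * - x)) \<le> C2 * exp (- 8 * - x)"
        unfolding C2_def using True by (intro double_exp_decay) auto
      then show ?thesis using True by (simp add: min_def)
    next
      case False
      have "exp (- exp (- x)) \<le> 1" by simp
      also note C1(2)
      finally show ?thesis using False by (simp add: min_def)
    qed
    then show ?thesis by (simp add: gumbel_density_def exp_diff exp_minus divide_inverse)
  qed
  show thesis
  proof
    show "0 < (C1 + C2) * 3096\<^sup>2" using C1 by simp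
    fix n x assume n: "extreme_level n"
    have "(growth x)\<^sup>2 * (exp (- x) * rescaled_cdf n x ^ (n - 3) + gumbel_density x)
      \<le> (growth x)\<^sup>2 * (exp (- x) * (C1 * exp (8 * min x 0)) + exp (- x) * (C2 * exp (8 * min x 0)))"
      by (intro mult_left_mono add_mono G[OF n] g) auto
    also have "\<dots> = (C1 + C2) * (exp (- x) * exp (8 * min x 0) * (growth x)\<^sup>2)"
      by (simp add: algebra_simps)
    also have "\<dots> \<le> (C1 + C2) * (3096\<^sup>2 * exp (- (1 / 2) * \<bar>x\<bar>))"
      using C1 by (intro mult_left_mono growth_square_le) auto
    finally show "(growth x)\<^sup>2 * (exp (- x) * rescaled_cdf n x ^ (n - 3) + gumbel_density x)
      \<le> (C1 + C2) * 3096\<^sup>2 * exp (- (1 / 2) * \<bar>x\<bar>)" by (simp only: mult.assoc)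
  qed
qed

section \<open>Pointwise limits at the scale of the rate\<close>

lemma filterlim_log_shift: "filterlim log_shift at_top sequentially"
  unfolding log_shift_def[abs_def] by real_asymp

text \<open>Because \<open>log_shift n = ln (4 \<pi> ln n) / 2\<close> is asymptotic to \<open>ln (ln n) / 2\<close>.\<close>

lemma rate_asymp: "(\<lambda>n. rate n / ((ln (ln (real n)))\<^sup>2 / (16 * ln (real n)))) \<longlonglongrightarrow> 1"
  unfolding rate_def log_shift_def by (real_asymp, simp add: power2_eq_square)

lemma rate_tendsto_0: "rate \<longlonglongrightarrow> 0"
  unfolding rate_def[abs_def] log_shift_def by real_asymp

text \<open>The error \<open>1 / n\<close> of the Poisson approximation is negligible against the rate, which is only
  of order \<open>(ln (ln n))\<^sup>2 / ln n\<close>.\<close>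

lemma inverse_rate_negligible: "(\<lambda>n. 1 / (real n * rate n)) \<longlonglongrightarrow> 0"
  unfolding rate_def log_shift_def by real_asymp

lemma eventually_extreme_level: "eventually extreme_level sequentially"
proof -
  have "eventually (\<lambda>n. 11 \<le> n) sequentially" by (rule eventually_ge_at_top)
  moreover have "eventually (\<lambda>n. 1 \<le> log_shift n) sequentially"
    using filterlim_log_shift by (auto simp: filterlim_at_top)
  moreover have "eventually (\<lambda>n. rate n < 1 / 2) sequentially"
    by (rule order_tendstoD(2)[OF rate_tendsto_0]) simp
  moreover have "eventually (\<lambda>n. 1 / real n < rate n) sequentially"
    unfolding rate_def log_shift_def by real_asymp
  ultimately show ?thesis
    by eventually_elim (auto simp: extreme_level_def)
qed

text \<open>The logarithmic derivative of the Gumbel density, and at the same time the first order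
  change of the logarithm of the density when the law of the maximum is replaced by its limit.\<close>

definition gumbel_tilt :: "real \<Rightarrow> real" where
  "gumbel_tilt x = exp (- x) - 1"

text \<open>The quotient is \<open>(x / c - 1)\<^sup>2\<close>, and \<open>c\<close> tends to infinity: at the scale of the rate
  the exponent does not depend on \<open>x\<close>.\<close>

lemma exponent_over_rate:
  "(\<lambda>n. (x - log_shift n)\<^sup>2 / (4 * ln (real n)) / rate n) \<longlonglongrightarrow> 1"
proof -
  have "(\<lambda>n. (x / log_shift n - 1)\<^sup>2) \<longlonglongrightarrow> (0 - 1)\<^sup>2"
    by (intro tendsto_intros tendsto_divide_0[OF tendsto_const]
        filterlim_mono[OF filterlim_log_shift at_top_le_at_infinity order.refl])
  moreover have "eventually (\<lambda>n. (x / log_shift n - 1)\<^sup>2 = (x - log_shift n)\<^sup>2 / (4 * ln (real n)) / rate n) sequentially"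
    using eventually_extreme_level
  proof eventually_elim
    case (elim n)
    interpret extreme_level n by fact
    have "x / c - 1 = (x - c) / c" using shift_ge by (simp add: field_simps)
    then show ?case using L_pos shift_ge by (simp add: rate_def power_divide)
  qed
  ultimately show ?thesis by (simp add: filterlim_cong)
qed

lemma damping_over_rate: "(\<lambda>n. (1 - damping n y) / rate n) \<longlonglongrightarrow> 1"
proof -
  define t where "t n = (y - log_shift n)\<^sup>2 / (4 * ln (real n))" for n
  have t: "(\<lambda>n. t n / rate n) \<longlonglongrightarrow> 1" unfolding t_def by (rule exponent_over_rate)
  have "(\<lambda>n. t n / rate n - (t n / rate n)\<^sup>2 * rate n) \<longlonglongrightarrow> 1 - 1\<^sup>2 * 0"
    by (intro tendsto_intros t rate_tendsto_0)
  then have lower: "(\<lambda>n. t n / rate n - (t n / rate n)\<^sup>2 * rate n) \<longlonglongrightarrow> 1" by simp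
  have ev: "eventually (\<lambda>n. t n / rate n - (t n / rate n)\<^sup>2 * rate n \<le> (1 - damping n y) / rate n
      \<and> (1 - damping n y) / rate n \<le> t n / rate n) sequentially"
    using eventually_extreme_level
  proof eventually_elim
    case (elim n)
    interpret extreme_level n by fact
    have t0: "0 \<le> t n" using L_pos by (simp add: t_def)
    have q: "q y = exp (- t n)" by (simp add: damping_def t_def)
    have "t n / \<delta> - (t n / \<delta>)\<^sup>2 * \<delta> = (t n - (t n)\<^sup>2) / \<delta>"
      using rate_pos by (simp add: field_simps power2_eq_square)
    also have "\<dots> \<le> (1 - q y) / \<delta>"
      using exp_minus_le[OF t0] rate_pos by (intro divide_right_mono) (auto simp: q)
    finally show ?case
      using exp_ge_add_one_self[of "- t n"] rate_pos by (auto simp: q intro!: divide_right_mono)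
  qed
  show ?thesis
    by (rule tendsto_sandwich[OF _ _ lower t]) (use ev in \<open>auto elim: eventually_mono\<close>)
qed

lemma tail_defect_over_rate: "(\<lambda>n. (exp (- x) - mean_exceedances n x) / rate n) \<longlonglongrightarrow> exp (- x)"
proof -
  let ?s = "\<lambda>n y. indicator {x<..} y * (exp (- y) * ((1 - damping n y) / rate n))"
  have [measurable]: "damping n \<in> borel_measurable borel" for n
    by (rule borel_measurable_continuous_onI[OF continuous_on_damping])
  have w: "integrable lborel (\<lambda>y. 2 * (indicator {x<..} y * (exp (- y) * (1 + y\<^sup>2))))"
    using has_integral_quadratic_exp_tail[of x] by (auto simp: has_bochner_integral_iff)
  have "(\<lambda>n. integral\<^sup>L lborel (?s n)) \<longlonglongrightarrow> (\<integral>y. indicator {x<..} y * (exp (- y) * 1) \<partial>lborel)"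
  proof (rule dominated_convergence_eventually(2)[OF _ w])
    show "(\<lambda>n. ?s n y) \<longlonglongrightarrow> indicator {x<..} y * (exp (- y) * 1)" for y
      by (intro tendsto_intros damping_over_rate)
    show "eventually (\<lambda>n. ?s n \<in> borel_measurable lborel \<and>
        (\<forall>y. \<bar>?s n y\<bar> \<le> 2 * (indicator {x<..} y * (exp (- y) * (1 + y\<^sup>2))))) sequentially"
      using eventually_extreme_level
    proof eventually_elim
      case (elim n)
      interpret extreme_level n by fact
      have "\<bar>(1 - q y) / \<delta>\<bar> \<le> 2 * (1 + y\<^sup>2)" for y
        using one_minus_damping_le[of y] damping_le_1[of y] rate_pos by (simp add: field_simps)
      then have "\<bar>exp (- y) * ((1 - q y) / \<delta>)\<bar> \<le> exp (- y) * (2 * (1 + y\<^sup>2))" for y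
        unfolding abs_mult by (intro mult_mono) auto
      then have "\<bar>exp (- y) * ((1 - q y) / \<delta>)\<bar> \<le> 2 * (exp (- y) * (1 + y\<^sup>2))" for y
        by (simp only: mult.left_commute)
      then show ?case by (auto simp: indicator_def)
    qed
  qed auto
  also have "(\<integral>y. indicator {x<..} y * (exp (- y) * 1) \<partial>lborel) = exp (- x)"
    using has_bochner_integral_integral_eq[OF has_integral_exp_tail, of x] by simp
  finally have lim: "(\<lambda>n. integral\<^sup>L lborel (?s n)) \<longlonglongrightarrow> exp (- x)" .
  have "eventually (\<lambda>n. integral\<^sup>L lborel (?s n) = (exp (- x) - mean_exceedances n x) / rate n) sequentially"
    using eventually_extreme_level
  proof eventually_elim
    case (elim n)
    interpret extreme_level n by fact
    from has_bochner_integral_divide_zero[OF has_integral_tail_defect, of x "\<delta>"] show ?case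
      by (simp add: has_bochner_integral_iff)
  qed
  from Lim_transform_eventually[OF lim this] show ?thesis .
qed

lemma rescaled_cdf_defect_over_rate: "(\<lambda>n. (1 - rescaled_cdf n x) / rate n) \<longlonglongrightarrow> 0"
proof (rule tendsto_sandwich[OF _ _ tendsto_const])
  show "(\<lambda>n. exp (- x) * (1 / (real n * rate n))) \<longlonglongrightarrow> 0"
    using tendsto_mult_left[OF inverse_rate_negligible, of "exp (- x)"] by simp
  show "eventually (\<lambda>n. 0 \<le> (1 - rescaled_cdf n x) / rate n) sequentially"
    using eventually_extreme_level
    by eventually_elim (auto intro!: divide_nonneg_pos simp: extreme_level.rescaled_cdf_le_1 extreme_level.rate_pos)
  show "eventually (\<lambda>n. (1 - rescaled_cdf n x) / rate n \<le> exp (- x) * (1 / (real n * rate n))) sequentially"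
    using eventually_extreme_level
  proof eventually_elim
    case (elim n)
    interpret extreme_level n by fact
    have "V x / real n / \<delta> \<le> exp (- x) / real n / \<delta>"
      using mean_exceedances_le[of x] rate_pos by (intro divide_right_mono) auto
    then show ?case by (simp add: one_minus_rescaled_cdf)
  qed
qed

lemma rescaled_cdf_tendsto_1: "(\<lambda>n. rescaled_cdf n x) \<longlonglongrightarrow> 1"
proof -
  have "(\<lambda>n. 1 - (1 - rescaled_cdf n x) / rate n * rate n) \<longlonglongrightarrow> 1 - 0 * 0"
    by (intro tendsto_intros rescaled_cdf_defect_over_rate rate_tendsto_0)
  moreover have "eventually (\<lambda>n. 1 - (1 - rescaled_cdf n x) / rate n * rate n = rescaled_cdf n x) sequentially"
    using eventually_extreme_level
    by eventually_elim (simp add: extreme_level.rate_pos less_imp_neq[THEN not_sym])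
  ultimately show ?thesis by (simp add: filterlim_cong)
qed

lemma log_cdf_over_rate:
  "(\<lambda>n. (real (n - 1) * ln (rescaled_cdf n x) + exp (- x)) / rate n) \<longlonglongrightarrow> exp (- x)"
proof -
  let ?d = "\<lambda>n. (exp (- x) - mean_exceedances n x) / rate n" and ?e = "\<lambda>n. 1 / (real n * rate n)"
  have "(\<lambda>n. ?d n + exp (- x) * ?e n) \<longlonglongrightarrow> exp (- x) + exp (- x) * 0"
    by (intro tendsto_intros tail_defect_over_rate inverse_rate_negligible)
  then have upper: "(\<lambda>n. ?d n + exp (- x) * ?e n) \<longlonglongrightarrow> exp (- x)" by simp
  have "(\<lambda>n. ?d n - 2 * (exp (- x))\<^sup>2 * ?e n) \<longlonglongrightarrow> exp (- x) - 2 * (exp (- x))\<^sup>2 * 0"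
    by (intro tendsto_intros tail_defect_over_rate inverse_rate_negligible)
  then have lower: "(\<lambda>n. ?d n - 2 * (exp (- x))\<^sup>2 * ?e n) \<longlonglongrightarrow> exp (- x)" by simp
  have le_upper: "eventually (\<lambda>n. (real (n - 1) * ln (rescaled_cdf n x) + exp (- x)) / rate n \<le> ?d n + exp (- x) * ?e n) sequentially"
    using eventually_extreme_level
  proof eventually_elim
    case (elim n)
    interpret extreme_level n by fact
    have "(real (n - 1) * ln (G x) + exp (- x)) / \<delta> \<le> ((exp (- x) - V x) + exp (- x) / real n) / \<delta>"
      using log_cdf_upper[of x] rate_pos by (intro divide_right_mono) auto
    then show ?case by (simp add: add_divide_distrib)
  qed
  have "eventually (\<lambda>n. 1 / 2 < rescaled_cdf n x) sequentially"
    by (rule order_tendstoD(1)[OF rescaled_cdf_tendsto_1]) simp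
  with eventually_extreme_level
  have ge_lower: "eventually (\<lambda>n. ?d n - 2 * (exp (- x))\<^sup>2 * ?e n \<le> (real (n - 1) * ln (rescaled_cdf n x) + exp (- x)) / rate n) sequentially"
  proof eventually_elim
    case (elim n)
    interpret extreme_level n by fact
    have "((exp (- x) - V x) - 2 * (exp (- x))\<^sup>2 / real n) / \<delta> \<le> (real (n - 1) * ln (G x) + exp (- x)) / \<delta>"
      using log_cdf_lower[of x] elim(2) rate_pos by (intro divide_right_mono) auto
    then show ?case by (simp add: diff_divide_distrib)
  qed
  show ?thesis by (rule tendsto_sandwich[OF ge_lower le_upper lower upper])
qed

lemma log_ratio_over_rate: "(\<lambda>n. log_ratio n x / rate n) \<longlonglongrightarrow> gumbel_tilt x"
proof -
  have "(\<lambda>n. (real (n - 1) * ln (rescaled_cdf n x) + exp (- x)) / rate n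
      - (x - log_shift n)\<^sup>2 / (4 * ln (real n)) / rate n) \<longlonglongrightarrow> gumbel_tilt x"
    unfolding gumbel_tilt_def by (intro tendsto_diff log_cdf_over_rate exponent_over_rate)
  then show ?thesis
    by (simp add: log_ratio_def add_divide_distrib diff_divide_distrib algebra_simps)
qed

lemma log_ratio_tendsto_0: "(\<lambda>n. log_ratio n x) \<longlonglongrightarrow> 0"
proof -
  have "(\<lambda>n. log_ratio n x / rate n * rate n) \<longlonglongrightarrow> gumbel_tilt x * 0"
    by (intro tendsto_intros log_ratio_over_rate rate_tendsto_0)
  moreover have "eventually (\<lambda>n. log_ratio n x / rate n * rate n = log_ratio n x) sequentially"
    using eventually_extreme_level
    by eventually_elim (simp add: extreme_level.rate_pos less_imp_neq[THEN not_sym])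
  ultimately show ?thesis by (simp add: filterlim_cong)
qed

lemma max_density_tendsto: "(\<lambda>n. max_density n x) \<longlonglongrightarrow> gumbel_density x"
proof -
  have "(\<lambda>n. gumbel_density x * exp (log_ratio n x)) \<longlonglongrightarrow> gumbel_density x * exp 0"
    by (intro tendsto_intros log_ratio_tendsto_0)
  moreover have "eventually (\<lambda>n. gumbel_density x * exp (log_ratio n x) = max_density n x) sequentially"
    using eventually_extreme_level by eventually_elim (simp add: extreme_level.max_density_eq)
  ultimately show ?thesis by (simp add: filterlim_cong)
qed

lemma density_diff_over_rate:
  "(\<lambda>n. (max_density n x - gumbel_density x) / rate n) \<longlonglongrightarrow> gumbel_tilt x * gumbel_density x"
proof -
  \<comment> \<open>The quotient is extended continuously because the logarithm of the ratio may vanish.\<close>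
  define \<psi> where "\<psi> l = (if l = 0 then 1 else (exp l - 1) / l)" for l :: real
  have "((\<lambda>l::real. (exp l - 1) / l) \<longlongrightarrow> 1) (at 0)" by real_asymp
  then have "(\<psi> \<longlongrightarrow> 1) (at 0)"
    by (rule Lim_transform_eventually) (auto simp: \<psi>_def eventually_at_filter)
  then have "isCont \<psi> 0" by (simp add: isCont_def \<psi>_def)
  from isCont_tendsto_compose[OF this log_ratio_tendsto_0[of x]]
  have "(\<lambda>n. \<psi> (log_ratio n x)) \<longlonglongrightarrow> 1" by (simp add: \<psi>_def)
  then have "(\<lambda>n. \<psi> (log_ratio n x) * (log_ratio n x / rate n) * gumbel_density x) \<longlonglongrightarrow> 1 * gumbel_tilt x * gumbel_density x"
    by (intro tendsto_mult log_ratio_over_rate tendsto_const)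
  note lim = this
  have "eventually (\<lambda>n. \<psi> (log_ratio n x) * (log_ratio n x / rate n) * gumbel_density x =
      (max_density n x - gumbel_density x) / rate n) sequentially"
    using eventually_extreme_level
    by eventually_elim (auto simp: extreme_level.max_density_eq \<psi>_def algebra_simps diff_divide_distrib)
  from Lim_transform_eventually[OF lim this] show ?thesis by simp
qed

lemma entropy_density_over_rate:
  "(\<lambda>n. (max_density n x * log_ratio n x - max_density n x + gumbel_density x) / (rate n)\<^sup>2)
     \<longlonglongrightarrow> (gumbel_tilt x)\<^sup>2 * gumbel_density x / 2"
proof -
  \<comment> \<open>The second order Taylor quotient of \<open>r ln r - r + 1\<close> in terms of \<open>l = ln r\<close>.\<close>
  define \<psi> where "\<psi> l = (if l = 0 then 1 / 2 else (exp l * l - exp l + 1) / l\<^sup>2)" for l :: real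
  have "((\<lambda>l::real. (exp l * l - exp l + 1) / l\<^sup>2) \<longlongrightarrow> 1 / 2) (at 0)" by real_asymp
  then have "(\<psi> \<longlongrightarrow> 1 / 2) (at 0)"
    by (rule Lim_transform_eventually) (auto simp: \<psi>_def eventually_at_filter)
  then have "isCont \<psi> 0" by (simp add: isCont_def \<psi>_def)
  from isCont_tendsto_compose[OF this log_ratio_tendsto_0[of x]]
  have "(\<lambda>n. \<psi> (log_ratio n x)) \<longlonglongrightarrow> 1 / 2" by (simp add: \<psi>_def)
  then have "(\<lambda>n. \<psi> (log_ratio n x) * (log_ratio n x / rate n)\<^sup>2 * gumbel_density x)
      \<longlonglongrightarrow> 1 / 2 * (gumbel_tilt x)\<^sup>2 * gumbel_density x"
    by (intro tendsto_mult tendsto_power log_ratio_over_rate tendsto_const)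
  moreover have "eventually (\<lambda>n. \<psi> (log_ratio n x) * (log_ratio n x / rate n)\<^sup>2 * gumbel_density x =
      (max_density n x * log_ratio n x - max_density n x + gumbel_density x) / (rate n)\<^sup>2) sequentially"
    using eventually_extreme_level
  proof eventually_elim
    case (elim n)
    interpret extreme_level n by fact
    define l where "l = log_ratio n x"
    have "\<psi> l * l\<^sup>2 = exp l * l - exp l + 1" by (simp add: \<psi>_def)
    then have "(\<psi> l * l\<^sup>2) * g x = (exp l * l - exp l + 1) * g x" by (simp only:)
    also have "\<dots> = f x * l - f x + g x" by (simp add: max_density_eq l_def algebra_simps)
    finally have "(\<psi> l * l\<^sup>2) * g x = f x * l - f x + g x" .
    then show ?case by (simp add: power_divide flip: l_def)
  qed
  ultimately show ?thesis by (simp add: filterlim_cong)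
qed

lemma score_over_rate: "(\<lambda>n. relative_score n x / rate n) \<longlonglongrightarrow> - exp (- x)"
proof -
  have at_inf: "filterlim log_shift at_infinity sequentially"
    by (rule filterlim_mono[OF filterlim_log_shift at_top_le_at_infinity order.refl])
  have c1: "(\<lambda>n. x / log_shift n) \<longlonglongrightarrow> 0" "(\<lambda>n. 1 / log_shift n) \<longlonglongrightarrow> 0"
    by (intro tendsto_divide_0[OF tendsto_const at_inf])+
  have damping_lim: "(\<lambda>n. damping n x) \<longlonglongrightarrow> 1"
  proof -
    have "(\<lambda>n. 1 - (1 - damping n x) / rate n * rate n) \<longlonglongrightarrow> 1 - 1 * 0"
      by (intro tendsto_intros damping_over_rate rate_tendsto_0)
    moreover have "eventually (\<lambda>n. 1 - (1 - damping n x) / rate n * rate n = damping n x) sequentially"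
      using eventually_extreme_level
      by eventually_elim (simp add: extreme_level.rate_pos less_imp_neq[THEN not_sym])
    ultimately show ?thesis by (simp add: filterlim_cong)
  qed
  let ?t = "\<lambda>n. - 2 * ((x / log_shift n - 1) * (1 / log_shift n)) +
    exp (- x) * ((- ((1 - damping n x) / rate n) - damping n x * (1 / (real n * rate n)) + (1 - rescaled_cdf n x) / rate n)
       / rescaled_cdf n x)"
  have "?t \<longlonglongrightarrow> - 2 * ((0 - 1) * 0) + exp (- x) * ((- 1 - 1 * 0 + 0) / 1)"
    by (intro tendsto_intros c1 damping_over_rate damping_lim inverse_rate_negligible
        rescaled_cdf_defect_over_rate rescaled_cdf_tendsto_1) auto
  moreover have "eventually (\<lambda>n. ?t n = relative_score n x / rate n) sequentially"
    using eventually_extreme_level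
  proof eventually_elim
    case (elim n)
    interpret extreme_level n by fact
    \<comment> \<open>The linear term of the score is of order \<open>c / L\<close>, that is, \<open>\<delta> / c\<close>.\<close>
    have 1: "- 2 * ((x / c - 1) * (1 / c)) = - (x - c) / (2 * L) / \<delta>"
      using L_pos shift_ge by (simp add: rate_def field_simps power2_eq_square)
    have 2: "(- ((1 - q x) / \<delta>) - q x * (1 / (real n * \<delta>)) + (1 - G x) / \<delta>) / G x
        = ((1 - 1 / real n) * q x / G x - 1) / \<delta>"
      using rate_pos rescaled_cdf_pos[of x] n_ge by (simp add: field_simps)
    show ?case unfolding 1 2 relative_score_def by (simp add: add_divide_distrib)
  qed
  ultimately show ?thesis by (simp add: filterlim_cong)
qed

section \<open>Integrals against the Gumbel density\<close>

lemma gumbel_density_eq: "gumbel_density x = exp (- x) * exp (- exp (- x))"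
  by (simp add: gumbel_density_def flip: exp_add)

lemma has_integral_gumbel_density: "has_bochner_integral lborel gumbel_density 1"
  and has_integral_gumbel_density_below:
    "has_bochner_integral lborel (\<lambda>y. indicator {..x} y * gumbel_density y) (exp (- exp (- x)))"
proof -
  have D: "((\<lambda>y. exp (- exp (- y))) has_real_derivative gumbel_density y) (at y)" for y
    unfolding gumbel_density_def by (auto intro!: derivative_eq_intros simp flip: exp_add)
  have c: "continuous_on UNIV gumbel_density"
    unfolding gumbel_density_def by (intro continuous_intros)
  have b: "((\<lambda>y::real. exp (- exp (- y))) \<longlongrightarrow> 0) at_bot" by real_asymp
  have t: "((\<lambda>y::real. exp (- exp (- y))) \<longlongrightarrow> 1) at_top" by real_asymp
  show "has_bochner_integral lborel gumbel_density 1"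
    using FTC_nonneg_line[OF D c _ b t] gumbel_density_pos by (simp add: less_imp_le)
  show "has_bochner_integral lborel (\<lambda>y. indicator {..x} y * gumbel_density y) (exp (- exp (- x)))"
    using FTC_nonneg_below[OF D c _ b, of x] gumbel_density_pos by (simp add: less_imp_le)
qed

lemma DERIV_gumbel_density: "(gumbel_density has_real_derivative gumbel_tilt x * gumbel_density x) (at x)"
  unfolding gumbel_density_def[abs_def] gumbel_tilt_def
  by (auto intro!: derivative_eq_intros simp: algebra_simps)

lemma continuous_on_gumbel_density: "continuous_on A gumbel_density"
  unfolding gumbel_density_def by (intro continuous_intros)

lemma continuous_on_gumbel_tilt: "continuous_on A gumbel_tilt"
  unfolding gumbel_tilt_def by (intro continuous_intros)

lemma gumbel_density_measurable [measurable]: "gumbel_density \<in> borel_measurable borel"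
  by (rule borel_measurable_continuous_onI[OF continuous_on_gumbel_density])

lemma gumbel_tilt_measurable [measurable]: "gumbel_tilt \<in> borel_measurable borel"
  by (rule borel_measurable_continuous_onI[OF continuous_on_gumbel_tilt])

lemma gumbel_density_0: "gumbel_density 0 = exp (- 1)"
  by (simp add: gumbel_density_def)

lemma gumbel_density_le: "gumbel_density x \<le> exp (- 1)"
  using exp_ge_add_one_self[of "- x"] by (simp add: gumbel_density_def)

lemma has_integral_gumbel_exp:
  "has_bochner_integral lborel (\<lambda>y. indicator {..x} y * (exp (- y) * gumbel_density y))
     ((1 + exp (- x)) * exp (- exp (- x)))"
proof -
  have b: "((\<lambda>y::real. (1 + exp (- y)) * exp (- exp (- y))) \<longlongrightarrow> 0) at_bot" by real_asymp
  have "has_bochner_integral lborel (\<lambda>y. indicator {..x} y * (exp (- y) * gumbel_density y))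
     ((1 + exp (- x)) * exp (- exp (- x)) - 0)"
  proof (rule FTC_nonneg_below[OF _ _ _ b])
    show "((\<lambda>y. (1 + exp (- y)) * exp (- exp (- y))) has_real_derivative exp (- y) * gumbel_density y) (at y)" for y
      unfolding gumbel_density_eq
      by (auto intro!: derivative_eq_intros simp: algebra_simps)
    show "continuous_on UNIV (\<lambda>y. exp (- y) * gumbel_density y)"
      by (intro continuous_intros continuous_on_gumbel_density)
    show "0 \<le> exp (- y) * gumbel_density y" for y
      using gumbel_density_pos[of y] by simp
  qed
  then show ?thesis by simp
qed

text \<open>This says that \<open>gumbel_tilt * gumbel_density\<close> is the derivative of \<open>gumbel_density\<close>. As the
  integrand changes sign, it is split into the difference of two nonnegative integrands.\<close>

lemma has_integral_tilt_below:
  "has_bochner_integral lborel (\<lambda>y. indicator {..x} y * (gumbel_tilt y * gumbel_density y)) (gumbel_density x)"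
proof -
  have "has_bochner_integral lborel
     (\<lambda>y. indicator {..x} y * (exp (- y) * gumbel_density y) - indicator {..x} y * gumbel_density y)
     ((1 + exp (- x)) * exp (- exp (- x)) - exp (- exp (- x)))"
    by (intro has_bochner_integral_diff has_integral_gumbel_exp has_integral_gumbel_density_below)
  also have "(1 + exp (- x)) * exp (- exp (- x)) - exp (- exp (- x)) = gumbel_density x"
    by (simp add: gumbel_density_eq algebra_simps)
  finally show ?thesis by (simp add: gumbel_tilt_def algebra_simps)
qed

text \<open>The density increases up to its mode 0 and decreases from there on, so its total variation
  is twice its maximum.\<close>

lemma has_integral_abs_tilt:
  "has_bochner_integral lborel (\<lambda>y. \<bar>gumbel_tilt y * gumbel_density y\<bar>) (2 * exp (- 1))"
proof -
  have t: "(gumbel_density \<longlongrightarrow> 0) at_top" unfolding gumbel_density_def by real_asymp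
  have t': "((\<lambda>y. - gumbel_density y) \<longlongrightarrow> 0) at_top" using tendsto_minus[OF t] by simp
  have "has_bochner_integral lborel (\<lambda>y. indicator {0<..} y * - (gumbel_tilt y * gumbel_density y)) (0 - - gumbel_density 0)"
  proof (rule FTC_nonneg_above[OF _ _ _ t'])
    show "((\<lambda>y. - gumbel_density y) has_real_derivative - (gumbel_tilt y * gumbel_density y)) (at y)" for y
      by (rule DERIV_minus[OF DERIV_gumbel_density])
    show "continuous_on UNIV (\<lambda>y. - (gumbel_tilt y * gumbel_density y))"
      by (intro continuous_intros continuous_on_gumbel_tilt continuous_on_gumbel_density)
    show "0 \<le> - (gumbel_tilt y * gumbel_density y)" if "0 \<le> y" for y
      using that gumbel_density_pos[of y] by (simp add: gumbel_tilt_def mult_nonpos_nonneg)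
  qed
  from has_bochner_integral_add[OF has_integral_tilt_below[of 0] this]
  have "has_bochner_integral lborel
     (\<lambda>y. indicator {..0} y * (gumbel_tilt y * gumbel_density y) + indicator {0<..} y * - (gumbel_tilt y * gumbel_density y))
     (2 * exp (- 1))" by (simp add: gumbel_density_0)
  also have "(\<lambda>y. indicator {..0} y * (gumbel_tilt y * gumbel_density y) + indicator {0<..} y * - (gumbel_tilt y * gumbel_density y))
      = (\<lambda>y. \<bar>gumbel_tilt y * gumbel_density y\<bar>)"
    using gumbel_density_pos by (auto simp: fun_eq_iff indicator_def abs_mult gumbel_tilt_def less_imp_le abs_if algebra_simps)
  finally show ?thesis .
qed

lemma has_integral_tilt_square:
  "has_bochner_integral lborel (\<lambda>y. (gumbel_tilt y)\<^sup>2 * gumbel_density y) 1"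
proof -
  have b: "((\<lambda>y::real. (exp (- y) ^ 2 + 1) * exp (- exp (- y))) \<longlongrightarrow> 0) at_bot" by real_asymp
  have t: "((\<lambda>y::real. (exp (- y) ^ 2 + 1) * exp (- exp (- y))) \<longlongrightarrow> 1) at_top" by real_asymp
  have "has_bochner_integral lborel (\<lambda>y. (gumbel_tilt y)\<^sup>2 * gumbel_density y) (1 - 0)"
  proof (rule FTC_nonneg_line[OF _ _ _ b t])
    show "((\<lambda>y. (exp (- y) ^ 2 + 1) * exp (- exp (- y))) has_real_derivative (gumbel_tilt y)\<^sup>2 * gumbel_density y) (at y)" for y
      unfolding gumbel_density_eq gumbel_tilt_def
      by (auto intro!: derivative_eq_intros simp: algebra_simps power2_eq_square)
    show "continuous_on UNIV (\<lambda>y. (gumbel_tilt y)\<^sup>2 * gumbel_density y)"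
      by (intro continuous_intros continuous_on_gumbel_tilt continuous_on_gumbel_density)
    show "0 \<le> (gumbel_tilt y)\<^sup>2 * gumbel_density y" for y
      using gumbel_density_pos[of y] by simp
  qed
  then show ?thesis by simp
qed

lemma has_integral_exp_square:
  "has_bochner_integral lborel (\<lambda>y. (exp (- y))\<^sup>2 * gumbel_density y) 2"
proof -
  have b: "((\<lambda>y::real. (exp (- y) ^ 2 + 2 * exp (- y) + 2) * exp (- exp (- y))) \<longlongrightarrow> 0) at_bot" by real_asymp
  have t: "((\<lambda>y::real. (exp (- y) ^ 2 + 2 * exp (- y) + 2) * exp (- exp (- y))) \<longlongrightarrow> 2) at_top" by real_asymp
  have "has_bochner_integral lborel (\<lambda>y. (exp (- y))\<^sup>2 * gumbel_density y) (2 - 0)"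
  proof (rule FTC_nonneg_line[OF _ _ _ b t])
    show "((\<lambda>y. (exp (- y) ^ 2 + 2 * exp (- y) + 2) * exp (- exp (- y))) has_real_derivative (exp (- y))\<^sup>2 * gumbel_density y) (at y)" for y
      unfolding gumbel_density_eq
      by (auto intro!: derivative_eq_intros simp: algebra_simps power2_eq_square)
    show "continuous_on UNIV (\<lambda>y. (exp (- y))\<^sup>2 * gumbel_density y)"
      by (intro continuous_intros continuous_on_gumbel_density)
    show "0 \<le> (exp (- y))\<^sup>2 * gumbel_density y" for y
      using gumbel_density_pos[of y] by simp
  qed
  then show ?thesis by simp
qed

section \<open>Distances as integrals of the densities\<close>

context extreme_level
begin

lemma continuous_on_rescaled_cdf: "continuous_on A G"
  by (rule DERIV_continuous_on[OF has_field_derivative_at_within[OF DERIV_rescaled_cdf]])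

lemma continuous_on_max_density: "continuous_on A f"
  unfolding max_density_def by (intro continuous_intros continuous_on_damping continuous_on_rescaled_cdf)

lemma continuous_on_log_ratio: "continuous_on A (log_ratio n)"
  by (rule DERIV_continuous_on[OF has_field_derivative_at_within[OF DERIV_log_ratio]])

lemma continuous_on_relative_score: "continuous_on A (relative_score n)"
  unfolding relative_score_def divide_inverse
  by (intro continuous_intros continuous_on_damping continuous_on_rescaled_cdf)
     (use rescaled_cdf_pos in \<open>auto simp: less_imp_neq[THEN not_sym]\<close>)

lemma measurable_level [measurable]:
  "f \<in> borel_measurable borel" "log_ratio n \<in> borel_measurable borel"
  "relative_score n \<in> borel_measurable borel" "G \<in> borel_measurable borel"
  by (rule borel_measurable_continuous_onI continuous_on_max_density continuous_on_log_ratio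
      continuous_on_relative_score continuous_on_rescaled_cdf)+

lemma has_integral_max_density:
  "has_bochner_integral lborel f 1"
  "has_bochner_integral lborel (\<lambda>y. indicator {..x} y * f y) (G x ^ n)"
proof -
  have D: "((\<lambda>y. G y ^ n) has_real_derivative f y) (at y)" for y
    using DERIV_power[OF DERIV_rescaled_cdf[of y], of n] n_ge
    by (simp add: max_density_def rescaled_density_def ac_simps)
  have 0: "(G \<longlongrightarrow> 0) at_bot"
  proof (rule tendsto_sandwich[OF _ _ tendsto_const])
    show "((\<lambda>x::real. exp x) \<longlongrightarrow> 0) at_bot" by (rule exp_at_bot)
    show "eventually (\<lambda>x. G x \<le> exp x) at_bot"
      using eventually_le_at_bot[of "- 8 * L"] by eventually_elim (rule rescaled_cdf_le_exp)
  qed (simp add: rescaled_cdf_nonneg)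
  have 1: "(G \<longlongrightarrow> 1) at_top"
  proof (rule tendsto_sandwich[OF _ _ _ tendsto_const])
    show "((\<lambda>x. 1 - \<delta> * exp (- x)) \<longlongrightarrow> 1) at_top" by real_asymp
    show "eventually (\<lambda>x. 1 - \<delta> * exp (- x) \<le> G x) at_top"
      by (rule always_eventually) (use one_minus_rescaled_cdf_le in \<open>auto simp: algebra_simps\<close>)
  qed (simp add: rescaled_cdf_le_1)
  have lim0: "((\<lambda>x. G x ^ n) \<longlongrightarrow> 0) at_bot"
    using tendsto_power[OF 0, of n] n_ge by (simp add: power_0_left)
  have lim1: "((\<lambda>x. G x ^ n) \<longlongrightarrow> 1) at_top"
    using tendsto_power[OF 1, of n] by simp
  show "has_bochner_integral lborel f 1"
    using FTC_nonneg_line[OF D continuous_on_max_density _ lim0 lim1] max_density_pos by (simp add: less_imp_le)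
  show "has_bochner_integral lborel (\<lambda>y. indicator {..x} y * f y) (G x ^ n)"
    using FTC_nonneg_below[OF D continuous_on_max_density _ lim0, of x] max_density_pos by (simp add: less_imp_le)
qed

lemma has_integral_density_diff:
  "has_bochner_integral lborel (\<lambda>y. f y - g y) 0"
  "has_bochner_integral lborel (\<lambda>y. indicator {..x} y * (f y - g y)) (G x ^ n - exp (- exp (- x)))"
  using has_bochner_integral_diff[OF has_integral_max_density(1) has_integral_gumbel_density]
    has_bochner_integral_diff[OF has_integral_max_density(2)[of x] has_integral_gumbel_density_below[of x]]
  by (simp_all add: right_diff_distrib)

text \<open>The two integrands differ by \<open>f - g\<close>, which has integral zero.\<close>

lemma integral_entropy: "(\<integral>x. f x * ln (f x / g x) \<partial>lborel) = (\<integral>x. f x * log_ratio n x - f x + g x \<partial>lborel)"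
  if "integrable lborel (\<lambda>x. f x * log_ratio n x - f x + g x)"
proof -
  have ln: "ln (f x / g x) = log_ratio n x" for x
    using gumbel_density_pos[of x] by (simp add: max_density_eq)
  have "has_bochner_integral lborel (\<lambda>x. (f x * log_ratio n x - f x + g x) + (f x - g x))
      ((\<integral>x. f x * log_ratio n x - f x + g x \<partial>lborel) + 0)"
    using that by (intro has_bochner_integral_add has_integral_density_diff has_bochner_integral_integrable)
  then show ?thesis
    by (simp add: ln has_bochner_integral_iff)
qed

text \<open>The root of the density ratio is \<open>exp (log_ratio / 2)\<close>; the factor \<open>1 / 4\<close> comes
  from the inner derivative.\<close>

lemma fisher_integrand:
  "(deriv (\<lambda>y. sqrt (f y / g y)) x)\<^sup>2 * g x = (relative_score n x)\<^sup>2 * f x / 4"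
proof -
  have "f y / g y = (exp (log_ratio n y / 2))\<^sup>2" for y
    using gumbel_density_pos[of y] by (simp add: max_density_eq exp_double[symmetric])
  then have "sqrt (f y / g y) = exp (log_ratio n y / 2)" for y
    by simp
  moreover have "((\<lambda>y. exp (log_ratio n y / 2)) has_real_derivative exp (log_ratio n x / 2) * (relative_score n x / 2)) (at x)"
    by (auto intro!: derivative_eq_intros DERIV_log_ratio)
  ultimately have "deriv (\<lambda>y. sqrt (f y / g y)) x = exp (log_ratio n x / 2) * (relative_score n x / 2)"
    by (simp only: DERIV_imp_deriv)
  then have "(deriv (\<lambda>y. sqrt (f y / g y)) x)\<^sup>2 = (relative_score n x)\<^sup>2 * exp (log_ratio n x) / 4"
    by (simp only: power_mult_distrib power_divide exp_double[symmetric]) simp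
  then show ?thesis
    by (simp only: max_density_eq) simp
qed

end

section \<open>Limits of the five distances\<close>

text \<open>The bounds of the last two parts in the form in which dominated convergence uses them. The
  explicit exponential shape of \<open>w\<close> allows it to be integrated over half-lines, which yields tail
  bounds for the distribution function.\<close>

lemma domination:
  obtains w where "integrable lborel w" and "\<And>x. 0 \<le> w x" and "\<And>x. w x = w 0 * exp (- (1 / 2) * \<bar>x\<bar>)"
    and "\<And>n x. extreme_level n \<Longrightarrow> \<bar>max_density n x - gumbel_density x\<bar> \<le> rate n * w x"
    and "\<And>n x. extreme_level n \<Longrightarrow>
      max_density n x * log_ratio n x - max_density n x + gumbel_density x \<le> (rate n)\<^sup>2 * w x"
    and "\<And>n x. extreme_level n \<Longrightarrow> (relative_score n x)\<^sup>2 * max_density n x \<le> (rate n)\<^sup>2 * w x"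
proof -
  obtain C where C: "0 < C" and dom: "\<And>n x. extreme_level n \<Longrightarrow>
      (growth x)\<^sup>2 * (exp (- x) * rescaled_cdf n x ^ (n - 3) + gumbel_density x) \<le> C * exp (- (1 / 2) * \<bar>x\<bar>)"
    by (rule uniform_domination) blast
  define w where "w x = C * exp (- (1 / 2) * \<bar>x\<bar>)" for x :: real
  show thesis
  proof (rule that[of w])
    show "integrable lborel w" unfolding w_def
      by (intro integrable_mult_right integrable_exp_neg_abs) simp
    show "0 \<le> w x" for x using C by (simp add: w_def)
    show "w x = w 0 * exp (- (1 / 2) * \<bar>x\<bar>)" for x by (simp add: w_def)
    fix n x assume n: "extreme_level n"
    interpret extreme_level n by fact
    let ?e = "exp (- x) * G x ^ (n - 3)"
    have sum: "f x + g x \<le> ?e + g x" using max_density_le[of x] by simp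
    have fg: "0 \<le> f x + g x" using max_density_pos[of x] gumbel_density_pos[of x] by simp
    have dom': "(B x)\<^sup>2 * (?e + g x) \<le> w x" using dom[OF n, of x] by (simp add: w_def)
    have B2: "B x \<le> (B x)\<^sup>2" using growth_ge_1[of x] by (simp add: power2_eq_square)
    have d2: "(B x)\<^sup>2 * (f x + g x) \<le> w x"
      using mult_left_mono[OF sum, of "(B x)\<^sup>2"] dom' by simp
    have "\<bar>f x - g x\<bar> \<le> \<delta> * (B x * (f x + g x))"
      using abs_density_diff_le[of x] by (simp add: mult.assoc)
    also have "\<dots> \<le> \<delta> * ((B x)\<^sup>2 * (f x + g x))"
      using rate_pos fg B2 by (intro mult_left_mono mult_right_mono) auto
    also have "\<dots> \<le> \<delta> * w x" using d2 rate_pos by (intro mult_left_mono) auto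
    finally show "\<bar>f x - g x\<bar> \<le> \<delta> * w x" .
    have "f x * log_ratio n x - f x + g x \<le> \<delta>\<^sup>2 * ((B x)\<^sup>2 * (f x + g x))"
      using entropy_density_le(2)[of x] by (simp add: power_mult_distrib mult.assoc)
    also have "\<dots> \<le> \<delta>\<^sup>2 * w x" using d2 by (intro mult_left_mono) auto
    finally show "f x * log_ratio n x - f x + g x \<le> \<delta>\<^sup>2 * w x" .
    have "(relative_score n x)\<^sup>2 * f x \<le> \<delta>\<^sup>2 * ((B x)\<^sup>2 * ?e)"
      using score_square_le[of x] by (simp add: power_mult_distrib mult.assoc)
    also have "\<dots> \<le> \<delta>\<^sup>2 * ((B x)\<^sup>2 * (?e + g x))"
      using gumbel_density_pos[of x] by (intro mult_left_mono) auto
    also have "\<dots> \<le> \<delta>\<^sup>2 * w x" using dom' by (intro mult_left_mono) auto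
    finally show "(relative_score n x)\<^sup>2 * f x \<le> \<delta>\<^sup>2 * w x" .
  qed
qed

lemma TV_over_rate:
  "(\<lambda>n. (\<integral>x. \<bar>max_density n x - gumbel_density x\<bar> \<partial>lborel) / rate n) \<longlonglongrightarrow> 2 * exp (- 1)"
proof -
  obtain w where w: "integrable lborel w"
    and le: "\<And>n x. extreme_level n \<Longrightarrow> \<bar>max_density n x - gumbel_density x\<bar> \<le> rate n * w x"
    by (rule domination) blast
  have "(\<lambda>n. \<integral>x. \<bar>(max_density n x - gumbel_density x) / rate n\<bar> \<partial>lborel)
      \<longlonglongrightarrow> (\<integral>x. \<bar>gumbel_tilt x * gumbel_density x\<bar> \<partial>lborel)"
  proof (rule dominated_convergence_eventually(2)[OF _ w])
    show "(\<lambda>n. \<bar>(max_density n x - gumbel_density x) / rate n\<bar>) \<longlonglongrightarrow> \<bar>gumbel_tilt x * gumbel_density x\<bar>" for x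
      by (intro tendsto_rabs density_diff_over_rate)
    show "eventually (\<lambda>n. (\<lambda>x. \<bar>(max_density n x - gumbel_density x) / rate n\<bar>) \<in> borel_measurable lborel \<and>
        (\<forall>x. \<bar>\<bar>(max_density n x - gumbel_density x) / rate n\<bar>\<bar> \<le> w x)) sequentially"
      using eventually_extreme_level
    proof eventually_elim
      case (elim n)
      interpret extreme_level n by fact
      show ?case using le[OF elim] rate_pos by (auto simp: divide_le_eq mult.commute)
    qed
  qed measurable
  also have "(\<integral>x. \<bar>gumbel_tilt x * gumbel_density x\<bar> \<partial>lborel) = 2 * exp (- 1)"
    using has_integral_abs_tilt by (rule has_bochner_integral_integral_eq)
  finally have lim: "(\<lambda>n. \<integral>x. \<bar>(max_density n x - gumbel_density x) / rate n\<bar> \<partial>lborel) \<longlonglongrightarrow> 2 * exp (- 1)" .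
  have "eventually (\<lambda>n. (\<integral>x. \<bar>(max_density n x - gumbel_density x) / rate n\<bar> \<partial>lborel)
      = (\<integral>x. \<bar>max_density n x - gumbel_density x\<bar> \<partial>lborel) / rate n) sequentially"
    using eventually_extreme_level
    by eventually_elim (simp add: extreme_level.rate_pos less_imp_le abs_of_pos)
  from Lim_transform_eventually[OF lim this] show ?thesis .
qed

text \<open>The \<open>L\<^sup>1\<close> error of the first order expansion of the density.\<close>

definition cdf_error :: "nat \<Rightarrow> real" where
  "cdf_error n = (\<integral>x. \<bar>(max_density n x - gumbel_density x) / rate n - gumbel_tilt x * gumbel_density x\<bar> \<partial>lborel)"

lemma cdf_error_tendsto_0: "cdf_error \<longlonglongrightarrow> 0"
proof -
  obtain w where w: "integrable lborel w"
    and le: "\<And>n x. extreme_level n \<Longrightarrow> \<bar>max_density n x - gumbel_density x\<bar> \<le> rate n * w x"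
    by (rule domination) blast
  have w': "integrable lborel (\<lambda>x. w x + \<bar>gumbel_tilt x * gumbel_density x\<bar>)"
    using w has_integral_abs_tilt by (auto simp: has_bochner_integral_iff)
  have "(\<lambda>n. cdf_error n) \<longlonglongrightarrow> integral\<^sup>L lborel (\<lambda>x::real. 0)"
    unfolding cdf_error_def
  proof (rule dominated_convergence_eventually(2)[OF _ w'])
    show "(\<lambda>n. \<bar>(max_density n x - gumbel_density x) / rate n - gumbel_tilt x * gumbel_density x\<bar>) \<longlonglongrightarrow> 0" for x
      using tendsto_rabs[OF tendsto_diff[OF density_diff_over_rate[of x] tendsto_const[of "gumbel_tilt x * gumbel_density x"]]]
      by simp
    show "eventually (\<lambda>n. (\<lambda>x. \<bar>(max_density n x - gumbel_density x) / rate n - gumbel_tilt x * gumbel_density x\<bar>)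
        \<in> borel_measurable lborel \<and>
        (\<forall>x. \<bar>\<bar>(max_density n x - gumbel_density x) / rate n - gumbel_tilt x * gumbel_density x\<bar>\<bar>
           \<le> w x + \<bar>gumbel_tilt x * gumbel_density x\<bar>)) sequentially"
      using eventually_extreme_level
    proof eventually_elim
      case (elim n)
      interpret extreme_level n by fact
      have "\<bar>(f x - g x) / \<delta>\<bar> \<le> w x" for x
        using le[OF elim, of x] rate_pos by (simp add: divide_le_eq mult.commute)
      then show ?case by (auto intro!: order.trans[OF abs_triangle_ineq4] add_right_mono)
    qed
  qed measurable
  then show ?thesis by simp
qed

text \<open>Integrating the first order expansion of the density over a half-line gives that of the
  distribution function, with an error that does not depend on \<open>x\<close>.\<close>

lemma (in extreme_level) cdf_expansion:
  "\<bar>(G x ^ n - exp (- exp (- x))) / \<delta> - g x\<bar> \<le> cdf_error n"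
proof -
  let ?u = "\<lambda>y. (f y - g y) / \<delta> - gumbel_tilt y * g y"
  have 1: "has_bochner_integral lborel
      (\<lambda>y. indicator {..x} y * (f y - g y) / \<delta> - indicator {..x} y * (gumbel_tilt y * g y))
      ((G x ^ n - exp (- exp (- x))) / \<delta> - g x)"
    by (intro has_bochner_integral_diff has_bochner_integral_divide_zero has_integral_density_diff has_integral_tilt_below)
  then have "\<bar>(G x ^ n - exp (- exp (- x))) / \<delta> - g x\<bar>
      = \<bar>\<integral>y. indicator {..x} y * (f y - g y) / \<delta> - indicator {..x} y * (gumbel_tilt y * g y) \<partial>lborel\<bar>"
    by (simp only: has_bochner_integral_iff)
  also have "\<dots> \<le> (\<integral>y. \<bar>indicator {..x} y * (f y - g y) / \<delta> - indicator {..x} y * (gumbel_tilt y * g y)\<bar> \<partial>lborel)"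
    by (rule integral_abs_bound)
  also have "\<dots> \<le> (\<integral>y. \<bar>?u y\<bar> \<partial>lborel)"
  proof (rule integral_mono)
    show "integrable lborel (\<lambda>y. \<bar>indicator {..x} y * (f y - g y) / \<delta> - indicator {..x} y * (gumbel_tilt y * g y)\<bar>)"
      using 1 by (intro integrable_abs) (simp only: has_bochner_integral_iff)
    have "integrable lborel (\<lambda>y. gumbel_tilt y * g y)"
      by (rule integrable_abs_cancel) (use has_integral_abs_tilt in \<open>auto simp: has_bochner_integral_iff\<close>)
    then show "integrable lborel (\<lambda>y. \<bar>?u y\<bar>)"
      using has_integral_density_diff(1)
      by (intro integrable_abs[OF Bochner_Integration.integrable_diff[OF integrable_divide_zero]])
        (simp_all only: has_bochner_integral_iff)
  qed (auto simp: indicator_def)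
  finally show ?thesis by (simp add: cdf_error_def)
qed

text \<open>The uniform expansion reduces the supremum to that of the Gumbel density, which is attained
  at 0.\<close>

lemma sup_over_rate:
  "(\<lambda>n. (SUP x. \<bar>rescaled_cdf n x ^ n - exp (- exp (- x))\<bar>) / rate n) \<longlonglongrightarrow> exp (- 1)"
proof -
  have lower: "(\<lambda>n. exp (- 1) - cdf_error n) \<longlonglongrightarrow> exp (- 1)"
    using tendsto_diff[OF tendsto_const cdf_error_tendsto_0, of "exp (- 1)"] by simp
  have upper: "(\<lambda>n. exp (- 1) + cdf_error n) \<longlonglongrightarrow> exp (- 1)"
    using tendsto_add[OF tendsto_const cdf_error_tendsto_0, of "exp (- 1)"] by simp
  let ?S = "\<lambda>n. (SUP x. \<bar>rescaled_cdf n x ^ n - exp (- exp (- x))\<bar>) / rate n"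
  have "eventually (\<lambda>n. exp (- 1) - cdf_error n \<le> ?S n \<and> ?S n \<le> exp (- 1) + cdf_error n) sequentially"
    using eventually_extreme_level
  proof eventually_elim
    case (elim n)
    interpret extreme_level n by fact
    let ?d = "\<lambda>x. G x ^ n - exp (- exp (- x))"
    have le: "\<bar>?d x\<bar> \<le> (exp (- 1) + cdf_error n) * \<delta>" for x
    proof -
      have "\<bar>?d x / \<delta>\<bar> \<le> exp (- 1) + cdf_error n"
        using cdf_expansion[of x] gumbel_density_le[of x] gumbel_density_pos[of x] by linarith
      then show ?thesis using rate_pos by (simp add: divide_le_eq)
    qed
    have "(SUP x. \<bar>?d x\<bar>) \<le> (exp (- 1) + cdf_error n) * \<delta>"
      by (rule cSUP_least) (use le in auto)
    moreover have "\<bar>?d 0\<bar> \<le> (SUP x. \<bar>?d x\<bar>)"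
      by (rule cSUP_upper) (use le in \<open>auto intro!: bdd_aboveI2\<close>)
    moreover have "exp (- 1) - cdf_error n \<le> \<bar>?d 0\<bar> / \<delta>"
    proof -
      have "exp (- 1) - cdf_error n \<le> ?d 0 / \<delta>"
        using cdf_expansion[of 0] by (simp add: gumbel_density_0)
      also have "\<dots> \<le> \<bar>?d 0\<bar> / \<delta>" using rate_pos by (intro divide_right_mono) auto
      finally show ?thesis .
    qed
    ultimately show ?case using rate_pos by (simp add: divide_le_eq le_divide_eq)
  qed
  then show ?thesis
    by (intro tendsto_sandwich[OF _ _ lower upper]) (auto elim: eventually_mono)
qed

text \<open>The majorant \<open>w\<close> of the densities gives the majorant \<open>J * exp (- \<bar>x\<bar> / 4)\<close> of the difference
  of the distribution functions. For \<open>x \<le> 0\<close> this is seen by integrating over \<open>(-\<infinity>, x]\<close>; for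
  \<open>x > 0\<close> one integrates over the complement instead, as \<open>f - g\<close> has integral zero.\<close>

lemma W1_over_rate:
  "(\<lambda>n. (\<integral>x. \<bar>rescaled_cdf n x ^ n - exp (- exp (- x))\<bar> \<partial>lborel) / rate n) \<longlonglongrightarrow> 1"
proof -
  obtain w where w: "integrable lborel w" "\<And>x. 0 \<le> w x" "\<And>x. w x = w 0 * exp (- (1 / 2) * \<bar>x\<bar>)"
    and le: "\<And>n x. extreme_level n \<Longrightarrow> \<bar>max_density n x - gumbel_density x\<bar> \<le> rate n * w x"
    by (rule domination) blast
  let ?e = "\<lambda>x::real. exp (- (1 / 4) * \<bar>x\<bar>)"
  have ie: "integrable lborel ?e" by (rule integrable_exp_neg_abs) simp
  define J where "J = w 0 * (\<integral>y. ?e y \<partial>lborel)"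
  have wI: "integrable lborel (\<lambda>x. J * ?e x)" using ie by simp
  have bound: "\<bar>rescaled_cdf n x ^ n - exp (- exp (- x))\<bar> \<le> rate n * (J * ?e x)" if "extreme_level n" for n x
  proof -
    interpret extreme_level n by fact
    have int: "has_bochner_integral lborel (\<lambda>y. (if 0 < x then indicator {..x} y - 1 else indicator {..x} y) * (f y - g y))
       (G x ^ n - exp (- exp (- x)))"
      using has_integral_density_diff(2)[of x]
        has_bochner_integral_diff[OF has_integral_density_diff(2)[of x] has_integral_density_diff(1)]
      by (cases "0 < x") (simp_all add: left_diff_distrib)
    \<comment> \<open>On the half-line away from the origin \<open>\<bar>x\<bar> \<le> \<bar>y\<bar>\<close>, so half of the decay in \<open>y\<close> can be turned
      into decay in \<open>x\<close>.\<close>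
    have pt: "\<bar>(if 0 < x then indicator {..x} y - 1 else indicator {..x} y) * (f y - g y)\<bar> \<le> (\<delta> * w 0 * ?e x) * ?e y" for y
    proof (cases "\<bar>y\<bar> < \<bar>x\<bar> \<or> (if 0 < x then y \<le> x else x < y)")
      case True
      then have "(if 0 < x then indicator {..x} y - 1 else indicator {..x} y) = (0::real)"
        by (auto simp: indicator_def split: if_splits)
      then show ?thesis using rate_pos w(2)[of 0] by simp
    next
      case False
      have "\<bar>(if 0 < x then indicator {..x} y - 1 else indicator {..x} y) * (f y - g y)\<bar> \<le> 1 * \<bar>f y - g y\<bar>"
        unfolding abs_mult by (intro mult_right_mono) (auto simp: indicator_def)
      also have "\<dots> \<le> \<delta> * w y" using le[OF that, of y] by simp
      also have "\<dots> = \<delta> * w 0 * exp (- (1 / 2) * \<bar>y\<bar>)" by (subst w(3)) simp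
      also have "\<dots> \<le> \<delta> * w 0 * exp (- (1 / 4) * \<bar>x\<bar> + - (1 / 4) * \<bar>y\<bar>)"
        using False rate_pos w(2)[of 0] by (intro mult_left_mono) (auto split: if_splits)
      also have "\<dots> = (\<delta> * w 0 * ?e x) * ?e y" by (simp only: exp_add mult.assoc)
      finally show ?thesis .
    qed
    have "\<bar>G x ^ n - exp (- exp (- x))\<bar> = \<bar>\<integral>y. (if 0 < x then indicator {..x} y - 1 else indicator {..x} y) * (f y - g y) \<partial>lborel\<bar>"
      using int by (simp only: has_bochner_integral_iff)
    also have "\<dots> \<le> (\<integral>y. \<bar>(if 0 < x then indicator {..x} y - 1 else indicator {..x} y) * (f y - g y)\<bar> \<partial>lborel)"
      by (rule integral_abs_bound)
    also have "\<dots> \<le> (\<integral>y. (\<delta> * w 0 * ?e x) * ?e y \<partial>lborel)"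
      using int by (intro integral_mono pt integrable_mult_right ie integrable_abs) (simp only: has_bochner_integral_iff)
    also have "\<dots> = \<delta> * (J * ?e x)" by (simp add: J_def)
    finally show ?thesis .
  qed
  have "(\<lambda>n. \<integral>x. \<bar>(rescaled_cdf n x ^ n - exp (- exp (- x))) / rate n\<bar> \<partial>lborel) \<longlonglongrightarrow> (\<integral>x. gumbel_density x \<partial>lborel)"
  proof (rule dominated_convergence_eventually(2)[OF _ wI])
    fix x
    let ?d = "\<lambda>n. (rescaled_cdf n x ^ n - exp (- exp (- x))) / rate n"
    have "(\<lambda>n. ?d n - gumbel_density x) \<longlonglongrightarrow> 0"
    proof (rule tendsto_rabs_zero_cancel, rule tendsto_sandwich[OF _ _ tendsto_const cdf_error_tendsto_0])
      show "eventually (\<lambda>n. \<bar>?d n - gumbel_density x\<bar> \<le> cdf_error n) sequentially"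
        using eventually_extreme_level by eventually_elim (rule extreme_level.cdf_expansion)
    qed simp
    then have "?d \<longlonglongrightarrow> gumbel_density x" by (simp add: LIM_zero_iff)
    from tendsto_rabs[OF this] show "(\<lambda>n. \<bar>?d n\<bar>) \<longlonglongrightarrow> gumbel_density x"
      using gumbel_density_pos[of x] by simp
  next
    show "eventually (\<lambda>n. (\<lambda>x. \<bar>(rescaled_cdf n x ^ n - exp (- exp (- x))) / rate n\<bar>) \<in> borel_measurable lborel \<and>
        (\<forall>x. \<bar>\<bar>(rescaled_cdf n x ^ n - exp (- exp (- x))) / rate n\<bar>\<bar> \<le> J * ?e x)) sequentially"
      using eventually_extreme_level
    proof eventually_elim
      case (elim n)
      interpret extreme_level n by fact
      have "\<bar>G x ^ n - exp (- exp (- x))\<bar> / \<delta> \<le> J * ?e x" for x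
        using bound[OF elim, of x] rate_pos by (subst pos_divide_le_eq) (simp_all only: mult.commute)
      then show ?case using rate_pos by simp
    qed
  qed measurable
  also have "(\<integral>x. gumbel_density x \<partial>lborel) = 1"
    using has_integral_gumbel_density by (rule has_bochner_integral_integral_eq)
  finally have lim: "(\<lambda>n. \<integral>x. \<bar>(rescaled_cdf n x ^ n - exp (- exp (- x))) / rate n\<bar> \<partial>lborel) \<longlonglongrightarrow> 1" .
  have "eventually (\<lambda>n. (\<integral>x. \<bar>(rescaled_cdf n x ^ n - exp (- exp (- x))) / rate n\<bar> \<partial>lborel)
      = (\<integral>x. \<bar>rescaled_cdf n x ^ n - exp (- exp (- x))\<bar> \<partial>lborel) / rate n) sequentially"
    using eventually_extreme_level
    by eventually_elim (simp add: extreme_level.rate_pos less_imp_le abs_of_pos)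
  from Lim_transform_eventually[OF lim this] show ?thesis .
qed

lemma KL_over_rate:
  "(\<lambda>n. (\<integral>x. max_density n x * ln (max_density n x / gumbel_density x) \<partial>lborel) / (rate n)\<^sup>2) \<longlonglongrightarrow> 1 / 2"
proof -
  obtain w where w: "integrable lborel w"
    and le: "\<And>n x. extreme_level n \<Longrightarrow>
      max_density n x * log_ratio n x - max_density n x + gumbel_density x \<le> (rate n)\<^sup>2 * w x"
    by (rule domination) blast
  let ?k = "\<lambda>n x. max_density n x * log_ratio n x - max_density n x + gumbel_density x"
  have abs: "\<bar>?k n x\<bar> \<le> (rate n)\<^sup>2 * w x" if "extreme_level n" for n x
    using le[OF that, of x] extreme_level.entropy_density_le(1)[OF that, of x] by simp
  have "(\<lambda>n. \<integral>x. ?k n x / (rate n)\<^sup>2 \<partial>lborel) \<longlonglongrightarrow> (\<integral>x. (gumbel_tilt x)\<^sup>2 * gumbel_density x / 2 \<partial>lborel)"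
  proof (rule dominated_convergence_eventually(2)[OF _ w])
    show "eventually (\<lambda>n. (\<lambda>x. ?k n x / (rate n)\<^sup>2) \<in> borel_measurable lborel \<and>
        (\<forall>x. \<bar>?k n x / (rate n)\<^sup>2\<bar> \<le> w x)) sequentially"
      using eventually_extreme_level
    proof eventually_elim
      case (elim n)
      interpret extreme_level n by fact
      have "\<bar>?k n x / \<delta>\<^sup>2\<bar> \<le> w x" for x
        using abs[OF elim, of x] rate_pos by (simp add: divide_le_eq mult.commute)
      then show ?case by simp
    qed
  qed (simp_all add: entropy_density_over_rate)
  also have "(\<integral>x. (gumbel_tilt x)\<^sup>2 * gumbel_density x / 2 \<partial>lborel) = 1 / 2"
    using has_integral_tilt_square by (simp add: has_bochner_integral_iff)
  finally have lim: "(\<lambda>n. \<integral>x. ?k n x / (rate n)\<^sup>2 \<partial>lborel) \<longlonglongrightarrow> 1 / 2" .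
  have "eventually (\<lambda>n. (\<integral>x. ?k n x / (rate n)\<^sup>2 \<partial>lborel)
      = (\<integral>x. max_density n x * ln (max_density n x / gumbel_density x) \<partial>lborel) / (rate n)\<^sup>2) sequentially"
    using eventually_extreme_level
  proof eventually_elim
    case (elim n)
    interpret extreme_level n by fact
    have "integrable lborel (?k n)"
    proof (rule Bochner_Integration.integrable_bound)
      show "integrable lborel (\<lambda>x. \<delta>\<^sup>2 * w x)" using w by simp
      show "AE x in lborel. norm (?k n x) \<le> norm (\<delta>\<^sup>2 * w x)"
        by (intro AE_I2) (use abs[OF elim] in \<open>simp add: order.trans[OF _ abs_ge_self]\<close>)
    qed measurable
    then show ?case by (simp add: integral_entropy)
  qed
  from Lim_transform_eventually[OF lim this] show ?thesis .
qed

lemma fisher_over_rate: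
  "(\<lambda>n. (\<integral>x. (deriv (\<lambda>y. sqrt (max_density n y / gumbel_density y)) x)\<^sup>2 * gumbel_density x \<partial>lborel) / (rate n)\<^sup>2)
     \<longlonglongrightarrow> 1 / 2"
proof -
  obtain w where w: "integrable lborel w"
    and le: "\<And>n x. extreme_level n \<Longrightarrow> (relative_score n x)\<^sup>2 * max_density n x \<le> (rate n)\<^sup>2 * w x"
    by (rule domination) blast
  let ?k = "\<lambda>n x. (relative_score n x)\<^sup>2 * max_density n x / (rate n)\<^sup>2"
  have "(\<lambda>n. \<integral>x. ?k n x \<partial>lborel) \<longlonglongrightarrow> (\<integral>x. (exp (- x))\<^sup>2 * gumbel_density x \<partial>lborel)"
  proof (rule dominated_convergence_eventually(2)[OF _ w])
    fix x
    have "(\<lambda>n. (relative_score n x / rate n)\<^sup>2 * max_density n x) \<longlonglongrightarrow> (- exp (- x))\<^sup>2 * gumbel_density x"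
      by (intro tendsto_intros score_over_rate max_density_tendsto)
    then show "(\<lambda>n. ?k n x) \<longlonglongrightarrow> (exp (- x))\<^sup>2 * gumbel_density x" by (simp add: power_divide)
  next
    show "eventually (\<lambda>n. ?k n \<in> borel_measurable lborel \<and> (\<forall>x. \<bar>?k n x\<bar> \<le> w x)) sequentially"
      using eventually_extreme_level
    proof eventually_elim
      case (elim n)
      interpret extreme_level n by fact
      have "\<bar>?k n x\<bar> \<le> w x" for x
        using le[OF elim, of x] rate_pos max_density_pos[of x]
        by (simp add: abs_mult divide_le_eq mult.commute)
      then show ?case by simp
    qed
  qed measurable
  also have "(\<integral>x. (exp (- x))\<^sup>2 * gumbel_density x \<partial>lborel) = 2"
    using has_integral_exp_square by (rule has_bochner_integral_integral_eq)
  finally have "(\<lambda>n. (\<integral>x. ?k n x \<partial>lborel) / 4) \<longlonglongrightarrow> 2 / 4"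
    by (intro tendsto_divide tendsto_const) auto
  then have lim: "(\<lambda>n. (\<integral>x. ?k n x \<partial>lborel) / 4) \<longlonglongrightarrow> 1 / 2" by simp
  have "eventually (\<lambda>n. (\<integral>x. ?k n x \<partial>lborel) / 4 =
    (\<integral>x. (deriv (\<lambda>y. sqrt (max_density n y / gumbel_density y)) x)\<^sup>2 * gumbel_density x \<partial>lborel) / (rate n)\<^sup>2) sequentially"
    using eventually_extreme_level
    by eventually_elim (simp add: extreme_level.fisher_integrand)
  from Lim_transform_eventually[OF lim this] show ?thesis .
qed

section \<open>The asymptotic equivalences\<close>

text \<open>The distances of first order use \<open>k = 1\<close>, entropy and Fisher information \<open>k = 2\<close>.\<close>

lemma asymp_equiv_of_rate:
  assumes lim: "(\<lambda>n. D n / (rate n) ^ k) \<longlonglongrightarrow> \<kappa>" and \<kappa>: "\<kappa> \<noteq> 0"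
    and eq: "eventually (\<lambda>n. D' n = D n) sequentially"
    and \<epsilon>: "\<And>n. \<epsilon> n = \<kappa> * ((ln (ln (real n)))\<^sup>2 / (16 * ln (real n))) ^ k"
  shows "D' \<sim>[at_top] \<epsilon>"
proof (rule asymp_equivI')
  let ?s = "\<lambda>n. (ln (ln (real n)))\<^sup>2 / (16 * ln (real n))"
  have "(\<lambda>n. D n / (rate n) ^ k / \<kappa> * (rate n / ?s n) ^ k) \<longlonglongrightarrow> \<kappa> / \<kappa> * 1 ^ k"
    using \<kappa> by (intro tendsto_intros lim rate_asymp) auto
  then have 1: "(\<lambda>n. D n / (rate n) ^ k / \<kappa> * (rate n / ?s n) ^ k) \<longlonglongrightarrow> 1" using \<kappa> by simp
  have "eventually (\<lambda>n. D n / (rate n) ^ k / \<kappa> * (rate n / ?s n) ^ k = D' n / \<epsilon> n) sequentially"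
    using eventually_extreme_level eq
  proof eventually_elim
    case (elim n)
    interpret extreme_level n by fact
    define A where "A = \<delta> ^ k"
    have "A \<noteq> 0" using rate_pos by (simp add: A_def)
    then show ?case unfolding \<epsilon> elim(2) power_divide[of "\<delta>"] A_def[symmetric] using \<kappa> by (simp add: field_simps)
  qed
  from Lim_transform_eventually[OF 1 this] show "(\<lambda>n. D' n / \<epsilon> n) \<longlonglongrightarrow> 1" .
qed

lemma gumbel_eq_density: "gumbel = density lborel (\<lambda>x. ennreal (gumbel_density x))"
  by (simp add: gumbel_def gumbel_density_def)

theorem theorem1:
  fixes M :: "'a measure" and X :: "nat \<Rightarrow> 'a \<Rightarrow> real"
  assumes "prob_space M"
    and "prob_space.indep_vars M (\<lambda>_. borel) X {1..}"
    and "\<And>i. i \<ge> 1 \<Longrightarrow> distributed M lborel (X i) std_normal_density"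
  shows
    "(\<lambda>n. SUP x. \<bar>measure M {\<omega> \<in> space M. normalized_max X n \<omega> \<le> x} - exp (- exp (- x))\<bar>)
        \<sim>[at_top] (\<lambda>n. (ln (ln (real n)))\<^sup>2 / (16 * exp 1 * ln (real n)))
     \<and> (\<lambda>n. W1_dist (distr M borel (normalized_max X n)) gumbel)
        \<sim>[at_top] (\<lambda>n. (ln (ln (real n)))\<^sup>2 / (16 * ln (real n)))
     \<and> (\<lambda>n. TV_dist (distr M borel (normalized_max X n)) gumbel)
        \<sim>[at_top] (\<lambda>n. (ln (ln (real n)))\<^sup>2 / (8 * exp 1 * ln (real n)))
     \<and> (\<lambda>n. KL_div (distr M borel (normalized_max X n)) gumbel)
        \<sim>[at_top] (\<lambda>n. (ln (ln (real n)))^4 / (512 * (ln (real n))\<^sup>2))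
     \<and> (\<lambda>n. relative_Fisher_information (distr M borel (normalized_max X n)) gumbel)
        \<sim>[at_top] (\<lambda>n. (ln (ln (real n)))^4 / (512 * (ln (real n))\<^sup>2))"
proof (intro conjI)
  have law: "distr M borel (normalized_max X n) = density lborel (\<lambda>x. ennreal (max_density n x))"
    and cdf: "cdf (distr M borel (normalized_max X n)) x = rescaled_cdf n x ^ n"
    and meas: "normalized_max X n \<in> borel_measurable M" if "2 \<le> n" for n x
    using distr_normalized_max[OF assms(1,2) _ that] cdf_normalized_max[OF assms(1,2) _ that]
      measurable_normalized_max[OF assms(1,2) _ that] assms(3) by blast+
  have two_le: "2 \<le> n" if "extreme_level n" for n
    using extreme_level.n_ge[OF that] by simp
  show "(\<lambda>n. SUP x. \<bar>measure M {\<omega> \<in> space M. normalized_max X n \<omega> \<le> x} - exp (- exp (- x))\<bar>)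
        \<sim>[at_top] (\<lambda>n. (ln (ln (real n)))\<^sup>2 / (16 * exp 1 * ln (real n)))"
  proof (rule asymp_equiv_of_rate[where k = 1, simplified, OF sup_over_rate])
    show "eventually (\<lambda>n. (SUP x. \<bar>measure M {\<omega> \<in> space M. normalized_max X n \<omega> \<le> x} - exp (- exp (- x))\<bar>)
        = (SUP x. \<bar>rescaled_cdf n x ^ n - exp (- exp (- x))\<bar>)) sequentially"
      using eventually_extreme_level
    proof eventually_elim
      case (elim n)
      note n = two_le[OF elim]
      have "measure M {\<omega> \<in> space M. normalized_max X n \<omega> \<le> x} = rescaled_cdf n x ^ n" for x
        unfolding cdf[OF n, symmetric] using meas[OF n]
        by (simp add: cdf_def measure_distr vimage_def Int_def conj_commute)
      then show ?case by simp
    qed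
  qed (auto simp: exp_minus field_simps)
  show "(\<lambda>n. W1_dist (distr M borel (normalized_max X n)) gumbel)
        \<sim>[at_top] (\<lambda>n. (ln (ln (real n)))\<^sup>2 / (16 * ln (real n)))"
  proof (rule asymp_equiv_of_rate[where k = 1, simplified, OF W1_over_rate])
    show "eventually (\<lambda>n. W1_dist (distr M borel (normalized_max X n)) gumbel
        = (\<integral>x. \<bar>rescaled_cdf n x ^ n - exp (- exp (- x))\<bar> \<partial>lborel)) sequentially"
      using eventually_extreme_level
      by eventually_elim (simp add: W1_dist_def cdf[OF two_le] cdf_gumbel)
  qed auto
  show "(\<lambda>n. TV_dist (distr M borel (normalized_max X n)) gumbel)
        \<sim>[at_top] (\<lambda>n. (ln (ln (real n)))\<^sup>2 / (8 * exp 1 * ln (real n)))"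
  proof (rule asymp_equiv_of_rate[where k = 1, simplified, OF TV_over_rate])
    show "eventually (\<lambda>n. TV_dist (distr M borel (normalized_max X n)) gumbel
        = (\<integral>x. \<bar>max_density n x - gumbel_density x\<bar> \<partial>lborel)) sequentially"
      using eventually_extreme_level
    proof eventually_elim
      case (elim n)
      interpret extreme_level n by fact
      show ?case unfolding law[OF two_le[OF elim]] gumbel_eq_density
        by (rule TV_dist_density) (use max_density_pos gumbel_density_pos in \<open>auto simp: less_imp_le\<close>)
    qed
  qed (auto simp: exp_minus field_simps)
  show "(\<lambda>n. KL_div (distr M borel (normalized_max X n)) gumbel)
        \<sim>[at_top] (\<lambda>n. (ln (ln (real n)))^4 / (512 * (ln (real n))\<^sup>2))"
  proof (rule asymp_equiv_of_rate[OF KL_over_rate])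
    show "eventually (\<lambda>n. KL_div (distr M borel (normalized_max X n)) gumbel
        = (\<integral>x. max_density n x * ln (max_density n x / gumbel_density x) \<partial>lborel)) sequentially"
      using eventually_extreme_level
    proof eventually_elim
      case (elim n)
      interpret extreme_level n by fact
      show ?case unfolding law[OF two_le[OF elim]] gumbel_eq_density
        by (rule KL_div_density) (use max_density_pos gumbel_density_pos in \<open>auto simp: less_imp_le\<close>)
    qed
  qed (auto simp: power_divide power_mult_distrib)
  show "(\<lambda>n. relative_Fisher_information (distr M borel (normalized_max X n)) gumbel)
        \<sim>[at_top] (\<lambda>n. (ln (ln (real n)))^4 / (512 * (ln (real n))\<^sup>2))"
  proof (rule asymp_equiv_of_rate[OF fisher_over_rate])
    show "eventually (\<lambda>n. relative_Fisher_information (distr M borel (normalized_max X n)) gumbel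
        = (\<integral>x. (deriv (\<lambda>y. sqrt (max_density n y / gumbel_density y)) x)\<^sup>2 * gumbel_density x \<partial>lborel)) sequentially"
      using eventually_extreme_level
    proof eventually_elim
      case (elim n)
      interpret extreme_level n by fact
      show ?case unfolding law[OF two_le[OF elim]] gumbel_eq_density relative_Fisher_information_def
        using max_density_pos gumbel_density_pos
        by (simp add: continuous_density_eq continuous_on_max_density continuous_on_gumbel_density less_imp_le)
    qed
  qed (auto simp: power_divide power_mult_distrib)
qed

end
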